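(* Let $g_{\mu\nu}=\eta_{\mu\nu}+\varkappa h_{\mu\nu}$ and assume $|\varkappa|\max_{\lambda\in\mathrm{EW}(h)}|\lambda|<1$, where $\mathrm{EW}(h)$ is the set of eigenvalues of $h$. The graviton-ghost $2$-point vertex Feynman rule of (effective) Quantum General Relativity is $$\mathfrak{C}_2^{\rho_1|\rho_2}(p)=\frac{i}{2\zeta}\,p^2\,\eta^{\rho_1\rho_2},$$ where $p_1=p$, $p_2=-p$. For $n>2$ the graviton-ghost $n$-point vertex Feynman rule is $$\mathfrak{C}_n^{\rho_1|\rho_2\|\mu_3\nu_3|\cdots|\mu_n\nu_n}(p_1,\dots,p_n)=\frac{i}{2^{n-2}}\sum_{\mu_i\leftrightarrow\nu_i}\;\sum_{s}\mathfrak{c}_n^{\rho_1|\rho_2\|\mu_{s(3)}\nu_{s(3)}|\cdots|\mu_{s(n)}\nu_{s(n)}}\big(p_1,p_2,p_{s(3)},\dots,p_{s(n)}\big),$$ where $s$ runs over all permutations of $\{3,\dots,n\}$, the sum $\sum_{\mu_i\leftrightarrow\nu_i}$ runs over all $2^{n-2}$ choices of exchanging or not exchanging $\mu_i$ and $\nu_i$ for each $i\in\{3,\dots,n\}$, and $$\begin{aligned}\mathfrak{c}_n^{\rho_1|\rho_2\|\mu_3\nu_3|\cdots|\mu_n\nu_n}(p_1,\dots,p_n)=\frac{(-\varkappa)^{n-2}}{4}\,N^{\rho_1\mu}\,\eta^{\rho_2\nu}\eta^{\rho\sigma}\Big[&p^{(2)}_\nu\big(p^{(3)}_\rho\delta^{\mu_3}_\mu\delta^{\nu_3}_\sigma+p^{(3)}_\sigma\delta^{\mu_3}_\rho\delta^{\nu_3}_\mu-p^{(3)}_\mu\delta^{\mu_3}_\rho\delta^{\nu_3}_\sigma\big)\\&-2p^{(2)}_\rho\big(p^{(3)}_\sigma\delta^{\mu_3}_\nu\delta^{\nu_3}_\mu+p^{(3)}_\nu\delta^{\mu_3}_\mu\delta^{\nu_3}_\sigma-p^{(3)}_\mu\delta^{\mu_3}_\sigma\delta^{\nu_3}_\nu\big)\Big],\end{aligned}$$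 with $N^{\rho_1\mu}=\eta^{\rho_1\mu}$ if $n=3$ and $N^{\rho_1\mu}=\eta^{\rho_1\nu_4}\eta^{\mu_4\nu_5}\eta^{\mu_5\nu_6}\cdots\eta^{\mu_{n-1}\nu_n}\eta^{\mu_n\mu}$ if $n\ge4$. Here particle $1$ is the graviton-ghost, particle $2$ is the graviton-antighost and the remaining particles are gravitons.
   Context: Spacetime is $\mathbb{R}^4$ with $\eta=\mathrm{diag}(1,-1,-1,-1)$; indices run over $0,\dots,3$, repeated Greek indices are summed, and indices of momenta and of the ghosts are raised and lowered with $\eta$; $p^2=\eta_{\mu\nu}p^\mu p^\nu$, $p\cdot x=\eta_{\alpha\beta}p^\alpha x^\beta$. $p^{(k)}_\mu$ denotes the components of the momentum $p_k$ of particle $k$. $\varkappa$ is the gravitational coupling constant, $\zeta\neq0$ the gauge parameter, $h$ a smooth symmetric $(0,2)$-tensor field, $g^{\mu\nu}$ the inverse of $g_{\mu\nu}$, $\Gamma_{\mu\nu\rho}=\frac12(\partial_\mu g_{\nu\rho}+\partial_\nu g_{\rho\mu}-\partial_\rho g_{\mu\nu})$ and $\Gamma^\nu{}_{\rho\sigma}=g^{\nu\lambda}\Gamma_{\rho\sigma\lambda}$. The ghost $C_\mu$ and antighost $\overline C_\mu$ are odd (Grassmann) fields, $\overline C^\mu=\eta^{\mu\nu}\overline C_\nu$. The ghost Lagrange density is $$\mathcal{L}_{\mathrm{Ghost}}=-\frac{1}{2\zeta}\eta^{\rho\sigma}\overline C^\mu\,\partial_\rho\partial_\sigma C_\mu-\frac12\eta^{\rho\sigma}\overline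 C^\mu\Big(\partial_\mu\big(\Gamma^\nu{}_{\rho\sigma}C_\nu\big)-2\,\partial_\rho\big(\Gamma^\nu{}_{\mu\sigma}C_\nu\big)\Big).$$ Definition of the $n$-point rule ($n\ge2$): let $\mathcal{L}^{n-2}$ be the part of $\mathcal{L}_{\mathrm{Ghost}}$ of order $\varkappa^{n-2}$ (including the factor $\varkappa^{n-2}$); it is of degree $n-2$ in $h$ and linear in each of $\overline C$ and $C$, with $\overline C$ written to the left of $C$. All momenta are incoming and satisfy $p_1+\dots+p_n=0$. Substitute $C_\mu=c_\mu e^{ip_1\cdot x}$, $\overline C_\mu=b_\mu e^{ip_2\cdot x}$ and $h_{\mu\nu}=\sum_{i=3}^n\epsilon_i a^{(i)}_{\mu\nu}e^{ip_i\cdot x}$ with constant $c,b$ and constant symmetric matrices $a^{(i)}$ (since each odd field occurs exactly once, in the order $\overline C\,C$, the coefficients $b,c$ may be treated as ordinary commuting numbers), and let $Q$ be the coefficient of $\epsilon_3\cdots\epsilon_n$, which is independent of $x$. Then $\mathfrak{C}_n$ is the unique tensor, symmetric under each exchange $\mu_i\leftrightarrow\nu_i$, with $\mathfrak{C}_n^{\rho_1|\rho_2\|\mu_3\nu_3|\cdots|\mu_n\nu_n}c_{\rho_1}b_{\rho_2}a^{(3)}_{\mu_3\nu_3}\cdots a^{(n)}_{\mu_n\nu_n}=i\,Q$. *)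

theory Defs
  imports "HOL-Complex_Analysis.Complex_Analysis" "HOL-Library.Poly_Mapping"
begin

text \<open>
  Spacetime is \<open>real ^ 4\<close>; the indices 0, 1, 2, 3 are the elements of the numeral type \<open>4\<close>.
  Since \<open>\<eta>\<close> equals its own inverse, \<open>eta\<close> serves for upper and for lower indices.
\<close>

definition eta :: "4 \<Rightarrow> 4 \<Rightarrow> real" where
  "eta \<mu> \<nu> = (if \<mu> = \<nu> then (if \<mu> = 0 then 1 else - 1) else 0)"

definition delta :: "4 \<Rightarrow> 4 \<Rightarrow> real" where
  "delta \<mu> \<nu> = (if \<mu> = \<nu> then 1 else 0)"

text \<open>Momenta and positions are given by their upper components.\<close>

definition mdot :: "real ^ 4 \<Rightarrow> real ^ 4 \<Rightarrow> real" where
  "mdot p x = (\<Sum>\<alpha>\<in>UNIV. \<Sum>\<beta>\<in>UNIV. eta \<alpha> \<beta> * p $ \<alpha> * x $ \<beta>)"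

definition lower :: "real ^ 4 \<Rightarrow> 4 \<Rightarrow> real" where
  "lower p \<mu> = (\<Sum>\<nu>\<in>UNIV. eta \<mu> \<nu> * p $ \<nu>)"

definition partial :: "4 \<Rightarrow> (real ^ 4 \<Rightarrow> 'a::real_normed_vector) \<Rightarrow> real ^ 4 \<Rightarrow> 'a" where
  "partial \<mu> f x = vector_derivative (\<lambda>t. f (x + t *\<^sub>R axis \<mu> 1)) (at 0)"

primrec Ck_field :: "nat \<Rightarrow> (real ^ 4 \<Rightarrow> 'a::real_normed_vector) \<Rightarrow> bool" where
  "Ck_field 0 f \<longleftrightarrow> continuous_on UNIV f"
| "Ck_field (Suc k) f \<longleftrightarrow> f differentiable_on UNIV \<and> (\<forall>\<mu>. Ck_field k (partial \<mu> f))"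

definition smooth_field :: "(real ^ 4 \<Rightarrow> 'a::real_normed_vector) \<Rightarrow> bool" where
  "smooth_field f \<longleftrightarrow> (\<forall>k. Ck_field k f)"

definition EW :: "real ^ 'n ^ 'n \<Rightarrow> real set" where
  "EW A = {l. \<exists>v. v \<noteq> 0 \<and> A *v v = l *\<^sub>R v}"


subsection \<open>The ghost Lagrange density\<close>

text \<open>
  Fields are complex valued because plane waves are substituted for them.  The coupling constant
  \<open>k\<close> is a complex argument, so that the order of a term in it can be read off from a power
  series.  The density is linear in \<open>Cb\<close> (antighost) and in \<open>C\<close> (ghost), and every term contains
  them in the order \<open>Cb C\<close>; for this reason their components are ordinary numbers.  Both carry
  lower indices.
\<close>

type_synonym covector_field = "real ^ 4 \<Rightarrow> complex ^ 4"
type_synonym tensor_field = "real ^ 4 \<Rightarrow> complex ^ 4 ^ 4"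

definition metric :: "complex \<Rightarrow> tensor_field \<Rightarrow> tensor_field" where
  "metric k h x = (\<chi> \<mu> \<nu>. complex_of_real (eta \<mu> \<nu>) + k * h x $ \<mu> $ \<nu>)"

definition Gamma_low :: "complex \<Rightarrow> tensor_field \<Rightarrow> 4 \<Rightarrow> 4 \<Rightarrow> 4 \<Rightarrow> real ^ 4 \<Rightarrow> complex" where
  "Gamma_low k h \<mu> \<nu> \<rho> x =
     (partial \<mu> (\<lambda>y. metric k h y $ \<nu> $ \<rho>) x
      + partial \<nu> (\<lambda>y. metric k h y $ \<rho> $ \<mu>) x
      - partial \<rho> (\<lambda>y. metric k h y $ \<mu> $ \<nu>) x) / 2"

definition Gamma_up :: "complex \<Rightarrow> tensor_field \<Rightarrow> 4 \<Rightarrow> 4 \<Rightarrow> 4 \<Rightarrow> real ^ 4 \<Rightarrow> complex" where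
  "Gamma_up k h \<nu> \<rho> \<sigma> x =
     (\<Sum>l\<in>UNIV. matrix_inv (metric k h x) $ \<nu> $ l * Gamma_low k h \<rho> \<sigma> l x)"

definition raise :: "complex ^ 4 \<Rightarrow> 4 \<Rightarrow> complex" where
  "raise b \<mu> = (\<Sum>\<nu>\<in>UNIV. complex_of_real (eta \<mu> \<nu>) * b $ \<nu>)"

definition ghost_lagrangian ::
  "complex \<Rightarrow> real \<Rightarrow> tensor_field \<Rightarrow> covector_field \<Rightarrow> covector_field \<Rightarrow> real ^ 4 \<Rightarrow> complex" where
  "ghost_lagrangian k \<zeta> h C Cb x =
     - 1 / (2 * complex_of_real \<zeta>) *
       (\<Sum>\<rho>\<in>UNIV. \<Sum>\<sigma>\<in>UNIV. \<Sum>\<mu>\<in>UNIV.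
          complex_of_real (eta \<rho> \<sigma>) * raise (Cb x) \<mu> * partial \<rho> (partial \<sigma> (\<lambda>y. C y $ \<mu>)) x)
     - 1 / 2 *
       (\<Sum>\<rho>\<in>UNIV. \<Sum>\<sigma>\<in>UNIV. \<Sum>\<mu>\<in>UNIV.
          complex_of_real (eta \<rho> \<sigma>) * raise (Cb x) \<mu> *
            (partial \<mu> (\<lambda>y. \<Sum>\<nu>\<in>UNIV. Gamma_up k h \<nu> \<rho> \<sigma> y * C y $ \<nu>) x
             - 2 * partial \<rho> (\<lambda>y. \<Sum>\<nu>\<in>UNIV. Gamma_up k h \<nu> \<mu> \<sigma> y * C y $ \<nu>) x))"

text \<open>The part of order \<open>\<kappa> ^ m\<close>, including the factor \<open>\<kappa> ^ m\<close>.\<close>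

definition ghost_order ::
  "nat \<Rightarrow> real \<Rightarrow> real \<Rightarrow> tensor_field \<Rightarrow> covector_field \<Rightarrow> covector_field \<Rightarrow> real ^ 4 \<Rightarrow> complex" where
  "ghost_order m \<kappa> \<zeta> h C Cb x =
     complex_of_real \<kappa> ^ m *
       fps_nth (fps_expansion (\<lambda>k. ghost_lagrangian k \<zeta> h C Cb x) 0) m"

definition complexify :: "(real ^ 4 \<Rightarrow> real ^ 4 ^ 4) \<Rightarrow> tensor_field" where
  "complexify h x = (\<chi> \<mu> \<nu>. complex_of_real (h x $ \<mu> $ \<nu>))"


subsection \<open>Vertex Feynman rules\<close>

definition wave :: "real ^ 4 \<Rightarrow> real ^ 4 \<Rightarrow> complex" where
  "wave p x = exp (\<i> * complex_of_real (mdot p x))"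

definition wave_covector :: "complex ^ 4 \<Rightarrow> real ^ 4 \<Rightarrow> covector_field" where
  "wave_covector c p x = (\<chi> \<mu>. c $ \<mu> * wave p x)"

definition wave_tensor ::
  "nat \<Rightarrow> (nat \<Rightarrow> complex) \<Rightarrow> (nat \<Rightarrow> complex ^ 4 ^ 4) \<Rightarrow> (nat \<Rightarrow> real ^ 4) \<Rightarrow> tensor_field" where
  "wave_tensor n \<epsilon> a p x = (\<chi> \<mu> \<nu>. \<Sum>i=3..n. \<epsilon> i * a i $ \<mu> $ \<nu> * wave (p i) x)"

text \<open>
  \<open>F\<close> is a polynomial function of the variables \<open>\<epsilon> i\<close>, and \<open>Q\<close> is the coefficient of the
  multilinear monomial \<open>\<Prod>i\<in>I. \<epsilon> i\<close>.  A polynomial is a finitely supported map from monomials,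
  i.e. finitely supported exponent maps, to coefficients.
\<close>

definition has_multilinear_coeff ::
  "((nat \<Rightarrow> complex) \<Rightarrow> complex) \<Rightarrow> nat set \<Rightarrow> complex \<Rightarrow> bool" where
  "has_multilinear_coeff F I Q \<longleftrightarrow>
     (\<exists>P :: (nat \<Rightarrow>\<^sub>0 nat) \<Rightarrow>\<^sub>0 complex.
        (\<forall>\<epsilon>. F \<epsilon> = (\<Sum>m\<in>Poly_Mapping.keys P. Poly_Mapping.lookup P m *
                      (\<Prod>i\<in>Poly_Mapping.keys m. \<epsilon> i ^ Poly_Mapping.lookup m i))) \<and>
        Q = Poly_Mapping.lookup P (\<Sum>i\<in>I. Poly_Mapping.single i 1))"

text \<open>
  An \<open>n\<close>-point tensor \<open>T \<rho>\<^sub>1 \<rho>\<^sub>2 \<mu> \<nu>\<close> has the graviton indices \<open>\<mu> i\<close>, \<open>\<nu> i\<close> for \<open>i \<in> {3..n}\<close>; it must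
  not depend on the values of \<open>\<mu>\<close> and \<open>\<nu>\<close> elsewhere.
\<close>

type_synonym vertex_tensor = "4 \<Rightarrow> 4 \<Rightarrow> (nat \<Rightarrow> 4) \<Rightarrow> (nat \<Rightarrow> 4) \<Rightarrow> complex"

definition is_vertex_tensor :: "nat \<Rightarrow> vertex_tensor \<Rightarrow> bool" where
  "is_vertex_tensor n T \<longleftrightarrow>
     (\<forall>\<rho>1 \<rho>2 \<mu> \<nu> \<mu>' \<nu>'. (\<forall>i\<in>{3..n}. \<mu> i = \<mu>' i \<and> \<nu> i = \<nu>' i)
        \<longrightarrow> T \<rho>1 \<rho>2 \<mu> \<nu> = T \<rho>1 \<rho>2 \<mu>' \<nu>')"

definition pair_symmetric :: "nat \<Rightarrow> vertex_tensor \<Rightarrow> bool" where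
  "pair_symmetric n T \<longleftrightarrow>
     (\<forall>i\<in>{3..n}. \<forall>\<rho>1 \<rho>2 \<mu> \<nu>. T \<rho>1 \<rho>2 (\<mu>(i := \<nu> i)) (\<nu>(i := \<mu> i)) = T \<rho>1 \<rho>2 \<mu> \<nu>)"

definition contract ::
  "nat \<Rightarrow> vertex_tensor \<Rightarrow> complex ^ 4 \<Rightarrow> complex ^ 4 \<Rightarrow> (nat \<Rightarrow> complex ^ 4 ^ 4) \<Rightarrow> complex" where
  "contract n T c b a =
     (\<Sum>\<rho>1\<in>UNIV. \<Sum>\<rho>2\<in>UNIV. \<Sum>\<mu>\<in>{3..n} \<rightarrow>\<^sub>E UNIV. \<Sum>\<nu>\<in>{3..n} \<rightarrow>\<^sub>E UNIV.
        T \<rho>1 \<rho>2 \<mu> \<nu> * c $ \<rho>1 * b $ \<rho>2 * (\<Prod>i=3..n. a i $ \<mu> i $ \<nu> i))"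

definition is_ghost_vertex ::
  "real \<Rightarrow> real \<Rightarrow> nat \<Rightarrow> (nat \<Rightarrow> real ^ 4) \<Rightarrow> vertex_tensor \<Rightarrow> bool" where
  "is_ghost_vertex \<kappa> \<zeta> n p T \<longleftrightarrow>
     is_vertex_tensor n T \<and> pair_symmetric n T \<and>
     (\<forall>c b a. (\<forall>i\<in>{3..n}. transpose (a i) = a i) \<longrightarrow>
        (\<exists>Q. (\<forall>x. has_multilinear_coeff
                     (\<lambda>\<epsilon>. ghost_order (n - 2) \<kappa> \<zeta> (wave_tensor n \<epsilon> a p)
                            (wave_covector c (p 1)) (wave_covector b (p 2)) x)
                     {3..n} Q) \<and>
             contract n T c b a = \<i> * Q))"

definition ghost_vertex :: "real \<Rightarrow> real \<Rightarrow> nat \<Rightarrow> (nat \<Rightarrow> real ^ 4) \<Rightarrow> vertex_tensor" where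
  "ghost_vertex \<kappa> \<zeta> n p = (THE T. is_ghost_vertex \<kappa> \<zeta> n p T)"


subsection \<open>The explicit expressions\<close>

definition N_factor :: "nat \<Rightarrow> 4 \<Rightarrow> 4 \<Rightarrow> (nat \<Rightarrow> 4) \<Rightarrow> (nat \<Rightarrow> 4) \<Rightarrow> real" where
  "N_factor n \<rho>1 l \<mu> \<nu> =
     (if n = 3 then eta \<rho>1 l
      else eta \<rho>1 (\<nu> 4) * (\<Prod>i=4..<n. eta (\<mu> i) (\<nu> (i + 1))) * eta (\<mu> n) l)"

text \<open>The summation indices \<open>\<mu>, \<nu>, \<rho>, \<sigma>\<close> of the contraction are called \<open>l, k, r, s\<close> here.\<close>

definition c_vertex ::
  "real \<Rightarrow> nat \<Rightarrow> 4 \<Rightarrow> 4 \<Rightarrow> (nat \<Rightarrow> 4) \<Rightarrow> (nat \<Rightarrow> 4) \<Rightarrow> (nat \<Rightarrow> real ^ 4) \<Rightarrow> real" where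
  "c_vertex \<kappa> n \<rho>1 \<rho>2 \<mu> \<nu> p =
     (- \<kappa>) ^ (n - 2) / 4 *
     (\<Sum>l\<in>UNIV. \<Sum>k\<in>UNIV. \<Sum>r\<in>UNIV. \<Sum>s\<in>UNIV.
        N_factor n \<rho>1 l \<mu> \<nu> * eta \<rho>2 k * eta r s *
        (lower (p 2) k *
           (lower (p 3) r * delta (\<mu> 3) l * delta (\<nu> 3) s
            + lower (p 3) s * delta (\<mu> 3) r * delta (\<nu> 3) l
            - lower (p 3) l * delta (\<mu> 3) r * delta (\<nu> 3) s)
         - 2 * lower (p 2) r *
           (lower (p 3) s * delta (\<mu> 3) k * delta (\<nu> 3) l
            + lower (p 3) k * delta (\<mu> 3) l * delta (\<nu> 3) s
            - lower (p 3) l * delta (\<mu> 3) s * delta (\<nu> 3) k)))"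

text \<open>\<open>swap_at S \<mu> \<nu>\<close> and \<open>swap_at S \<nu> \<mu>\<close> result from \<open>\<mu>\<close> and \<open>\<nu>\<close> by exchanging them on \<open>S\<close>.\<close>

definition swap_at :: "nat set \<Rightarrow> (nat \<Rightarrow> 4) \<Rightarrow> (nat \<Rightarrow> 4) \<Rightarrow> nat \<Rightarrow> 4" where
  "swap_at S \<mu> \<nu> i = (if i \<in> S then \<nu> i else \<mu> i)"

end

theory Submission
  imports Defs
begin

text \<open>
  For fixed \<open>x\<close> the density is a rational function of the coupling constant with poles only where
  the metric degenerates.  For a real symmetric \<open>h\<close> the operator norm is attained at an eigenvalue
  up to sign, so the assumption on \<open>EW\<close> keeps \<open>\<eta> + k h\<close> invertible for all complex \<open>k\<close> in a disc
  containing \<open>\<kappa>\<close>, and the Taylor series converges there.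

  For the vertex rules, the finite Neumann expansion
  \<open>G = (\<Sum>j<m. (- k) ^ j * (\<eta> h) ^ j \<eta>) + (- k) ^ m * (\<eta> h) ^ m G\<close> of the inverse metric is inserted
  before differentiating.  As the remainder stays holomorphic in \<open>k\<close>, the coefficients of the
  density are total derivatives of polynomials in \<open>h\<close>.  On plane waves each such polynomial is a
  sum over maps \<open>f\<close> from positions to gravitons; the multilinear coefficient selects the bijective
  \<open>f\<close>, and for these momentum conservation turns the total derivative into \<open>- \<i> p\<^sub>2\<close>.
\<close>

section \<open>Partial derivatives and plane waves\<close>

unbundle no fps_syntax

text \<open>The order of a term is a Taylor coefficient at \<open>k = 0\<close> taken outside the
  derivatives in \<open>x\<close>, while the inverse metric sits inside them. With an infinite
  Neumann series one would have to exchange the sum and the derivative. With finitely many terms and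
  an exact remainder, linearity of the derivative suffices, and a remainder divisible by
  \<open>k ^ (j + 1)\<close> leaves the coefficient of order \<open>j\<close> untouched. A second
  obstacle is that \<open>matrix_inv\<close> is meaningful only where the determinant is nonzero;
  its identities are therefore used on open sets in \<open>x\<close> and in \<open>k\<close>, the
  latter always containing 0. This is all that plane waves need: they are complex, so the eigenvalue
  bound, which concerns a real field, says nothing about them. Finally, \<open>ghost_vertex\<close>
  is a definite description. Besides a tensor with the right contractions one needs that polynomials
  are determined by their values and that a pair symmetric tensor is determined by its contractions
  with symmetric matrices.\<close>

lemma partial_eq:
  assumes "(f has_derivative f') (at x)"
  shows "partial \<mu> f x = f' (axis \<mu> 1)"
proof -
  have "((\<lambda>t::real. x + t *\<^sub>R axis \<mu> 1) has_derivative (\<lambda>t. t *\<^sub>R axis \<mu> 1)) (at 0)"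
    by (auto intro!: derivative_eq_intros)
  from has_derivative_compose[OF this, of f f'] assms
  have d: "((\<lambda>t. f (x + t *\<^sub>R axis \<mu> 1)) has_derivative (\<lambda>t. f' (t *\<^sub>R axis \<mu> 1))) (at 0)"
    by simp
  have "linear f'"
    using assms has_derivative_linear by blast
  then have "((\<lambda>t. f (x + t *\<^sub>R axis \<mu> 1)) has_vector_derivative f' (axis \<mu> 1)) (at 0)"
    using d by (simp add: has_vector_derivative_def linear_scale)
  then show ?thesis
    unfolding partial_def by (rule vector_derivative_at)
qed

text \<open>A derivative at \<open>x\<close> sees only the values near \<open>x\<close>. This form
  is needed because the identities for the inverse metric hold only where its determinant is
  nonzero.\<close>

lemma partial_cong_open:
  assumes "open S" "x \<in> S" "\<And>y. y \<in> S \<Longrightarrow> f y = g y"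
  shows "partial \<mu> f x = partial \<mu> g x"
proof -
  have "(\<lambda>t::real. x + t *\<^sub>R axis \<mu> 1) \<midarrow>0\<rightarrow> x + 0 *\<^sub>R axis \<mu> 1"
    by (intro tendsto_intros)
  then have "eventually (\<lambda>t::real. x + t *\<^sub>R axis \<mu> 1 \<in> S) (at 0)"
    using assms(1,2) by (auto dest: topological_tendstoD)
  then have "eventually (\<lambda>t::real. x + t *\<^sub>R axis \<mu> 1 \<in> S) (nhds 0)"
    unfolding eventually_at_filter by (rule eventually_mono) (use assms(2) in auto)
  then have "eventually (\<lambda>t::real. f (x + t *\<^sub>R axis \<mu> 1) = g (x + t *\<^sub>R axis \<mu> 1)) (nhds 0)"
    by (rule eventually_mono) (use assms(3) in auto)
  then show ?thesis
    unfolding partial_def by (intro vector_derivative_cong_eq) (simp_all add: eventually_nhds_x_imp_x)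
qed

lemma partial_const [simp]: "partial \<mu> (\<lambda>_. c) x = 0"
  by (simp add: partial_def)

lemma
  fixes f g :: "real ^ 4 \<Rightarrow> complex"
  assumes "f differentiable (at x)" "g differentiable (at x)"
  shows partial_add: "partial \<mu> (\<lambda>y. f y + g y) x = partial \<mu> f x + partial \<mu> g x"
    and partial_mult: "partial \<mu> (\<lambda>y. f y * g y) x = partial \<mu> f x * g x + f x * partial \<mu> g x"
proof -
  obtain f' g' where d: "(f has_derivative f') (at x)" "(g has_derivative g') (at x)"
    using assms unfolding differentiable_def by blast
  show "partial \<mu> (\<lambda>y. f y + g y) x = partial \<mu> f x + partial \<mu> g x"
    unfolding partial_eq[OF has_derivative_add[OF d]] by (simp add: d[THEN partial_eq])
  show "partial \<mu> (\<lambda>y. f y * g y) x = partial \<mu> f x * g x + f x * partial \<mu> g x"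
    unfolding partial_eq[OF has_derivative_mult[OF d]] by (simp add: d[THEN partial_eq])
qed

lemma partial_cmult:
  fixes f :: "real ^ 4 \<Rightarrow> complex"
  assumes "f differentiable (at x)"
  shows "partial \<mu> (\<lambda>y. c * f y) x = c * partial \<mu> f x"
  using partial_mult[of "\<lambda>_. c" x f \<mu>] assms by simp

lemma partial_sum:
  fixes f :: "'i \<Rightarrow> real ^ 4 \<Rightarrow> complex"
  assumes "\<And>i. i \<in> I \<Longrightarrow> f i differentiable (at x)"
  shows "partial \<mu> (\<lambda>y. \<Sum>i\<in>I. f i y) x = (\<Sum>i\<in>I. partial \<mu> (f i) x)"
  using assms
proof (induction I rule: infinite_finite_induct)
  case (insert i I)
  then show ?case by (simp add: partial_add)
qed simp_all

lemma eta_commute: "eta \<mu> \<nu> = eta \<nu> \<mu>"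
  by (simp add: eta_def)

lemma mdot_axis: "mdot p (axis \<mu> 1) = lower p \<mu>"
proof -
  have "(\<Sum>\<beta>\<in>UNIV. eta \<alpha> \<beta> * p $ \<alpha> * axis \<mu> (1::real) $ \<beta>) = eta \<alpha> \<mu> * p $ \<alpha>" for \<alpha>
    by (simp add: axis_def if_distrib[of "\<lambda>x. _ * x"] cong: if_cong)
  then show ?thesis
    unfolding mdot_def lower_def by (simp add: eta_commute)
qed

lemma linear_mdot: "linear (mdot p)"
  by (rule linearI)
     (simp_all add: mdot_def sum.distrib sum_distrib_left algebra_simps)

lemma wave_has_derivative:
  "(wave p has_derivative (\<lambda>v. \<i> * complex_of_real (mdot p v) * wave p x)) (at x)"
proof -
  have m: "(mdot p has_derivative mdot p) (at x)"
    using linear_mdot by (simp add: linear_imp_has_derivative)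
  have "((\<lambda>y. \<i> * complex_of_real (mdot p y)) has_derivative (\<lambda>v. \<i> * complex_of_real (mdot p v))) (at x)"
    by (intro derivative_intros m)
  then have "((\<lambda>y. exp (\<i> * complex_of_real (mdot p y))) has_derivative
      (\<lambda>v. exp (\<i> * complex_of_real (mdot p x)) * (\<i> * complex_of_real (mdot p v)))) (at x)"
    by (rule has_derivative_compose[where g = exp and g' = "(*) (exp (\<i> * complex_of_real (mdot p x)))"])
       (simp add: has_field_derivative_imp_has_derivative)
  then show ?thesis
    by (simp add: wave_def[abs_def] mult_ac)
qed

lemma wave_differentiable [simp]: "wave p differentiable (at x)"
  using wave_has_derivative unfolding differentiable_def by blast

lemma partial_wave: "partial \<mu> (wave p) x = \<i> * complex_of_real (lower p \<mu>) * wave p x"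
  by (simp add: partial_eq[OF wave_has_derivative] mdot_axis)

lemma mdot_add_left: "mdot (p + q) x = mdot p x + mdot q x"
  by (simp add: mdot_def sum.distrib algebra_simps)

lemma wave_add: "wave (p + q) x = wave p x * wave q x"
  by (simp add: wave_def mdot_add_left algebra_simps exp_add)

lemma wave_0 [simp]: "wave 0 x = 1"
  by (simp add: wave_def mdot_def)

lemma wave_sum: "wave (\<Sum>i\<in>I. p i) x = (\<Prod>i\<in>I. wave (p i) x)"
  by (induction I rule: infinite_finite_induct) (simp_all add: wave_add)

lemma lower_minus: "lower (- p) \<mu> = - lower p \<mu>"
  by (simp add: lower_def sum_negf)


section \<open>The inverse metric\<close>

definition etaM :: "complex ^ 4 ^ 4" where
  "etaM = (\<chi> \<mu> \<nu>. complex_of_real (eta \<mu> \<nu>))"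

lemma etaM_nth [simp]: "etaM $ \<mu> $ \<nu> = complex_of_real (eta \<mu> \<nu>)"
  by (simp add: etaM_def)

lemma etaM_etaM: "etaM ** etaM = mat 1"
  by (simp add: vec_eq_iff matrix_matrix_mult_def mat_def eta_def if_distrib[of "\<lambda>x. complex_of_real x * _"]
      if_distrib[of "\<lambda>x. _ * complex_of_real x"] cong: if_cong)

lemma metric_nth [simp]: "metric k h x $ \<mu> $ \<nu> = complex_of_real (eta \<mu> \<nu>) + k * h x $ \<mu> $ \<nu>"
  by (simp add: metric_def)

lemma
  fixes A :: "'a::field ^ 'n ^ 'n"
  assumes "det A \<noteq> 0"
  shows matrix_inv_right: "A ** matrix_inv A = mat 1" and matrix_inv_left: "matrix_inv A ** A = mat 1"
proof -
  have "\<exists>B. A ** B = mat 1 \<and> B ** A = mat 1"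
    using assms invertible_det_nz unfolding invertible_def by blast
  then have "A ** matrix_inv A = mat 1 \<and> matrix_inv A ** A = mat 1"
    unfolding matrix_inv_def by (rule someI_ex)
  then show "A ** matrix_inv A = mat 1" "matrix_inv A ** A = mat 1"
    by blast+
qed

lemma matrix_mult_add_rdistrib: "(A + B) ** C = A ** C + B ** (C :: 'a::semiring_1 ^ 'n ^ 'm)"
  by (simp add: vec_eq_iff matrix_matrix_mult_def sum.distrib distrib_right)

text \<open>Cramer's rule makes each entry a quotient of two determinants. Holomorphy in the
  coupling and differentiability in the position then both reduce to sums of products of
  entries.\<close>

lemma matrix_inv_nth_cramer:
  fixes A :: "'a::field ^ 'n ^ 'n"
  assumes "det A \<noteq> 0"
  shows "matrix_inv A $ i $ j = det (\<chi> a b. if b = i then axis j 1 $ a else A $ a $ b) / det A"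
proof -
  have "A ** matrix_inv A = mat 1"
    using assms by (rule matrix_inv_right)
  then have "A *v column j (matrix_inv A) = axis j 1"
    by (simp add: vec_eq_iff matrix_vector_mult_def matrix_matrix_mult_def column_def mat_def axis_def)
  then have "column j (matrix_inv A) = (\<chi> i. det (\<chi> a b. if b = i then axis j 1 $ a else A $ a $ b) / det A)"
    using cramer[OF assms] by blast
  then have "column j (matrix_inv A) $ i = det (\<chi> a b. if b = i then axis j 1 $ a else A $ a $ b) / det A"
    by simp
  then show ?thesis
    by (simp add: column_def)
qed

lemma differentiable_prod:
  fixes f :: "'i \<Rightarrow> 'a::real_normed_vector \<Rightarrow> 'b::real_normed_field"
  assumes "\<And>i. i \<in> I \<Longrightarrow> f i differentiable (at x)"
  shows "(\<lambda>y. \<Prod>i\<in>I. f i y) differentiable (at x)"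
  using assms by (induction I rule: infinite_finite_induct) simp_all

lemma differentiable_det:
  fixes A :: "'a::real_normed_vector \<Rightarrow> 'b::real_normed_field ^ 'n ^ 'n"
  assumes "\<And>i j. (\<lambda>y. A y $ i $ j) differentiable (at x)"
  shows "(\<lambda>y. det (A y)) differentiable (at x)"
  unfolding det_def
  by (intro differentiable_sum ballI differentiable_mult differentiable_prod assms) (simp_all add: finite_permutations)

lemma holomorphic_on_det:
  fixes A :: "complex \<Rightarrow> complex ^ 'n ^ 'n"
  assumes "\<And>i j. (\<lambda>k. A k $ i $ j) holomorphic_on S"
  shows "(\<lambda>k. det (A k)) holomorphic_on S"
  unfolding det_def
  by (intro holomorphic_intros assms)

abbreviation gdet :: "complex \<Rightarrow> tensor_field \<Rightarrow> real ^ 4 \<Rightarrow> complex" where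
  "gdet k h x \<equiv> det (metric k h x)"

abbreviation ginv :: "complex \<Rightarrow> tensor_field \<Rightarrow> real ^ 4 \<Rightarrow> complex ^ 4 ^ 4" where
  "ginv k h x \<equiv> matrix_inv (metric k h x)"

definition diff_tensor :: "tensor_field \<Rightarrow> bool" where
  "diff_tensor h \<longleftrightarrow> (\<forall>\<mu> \<nu> x. (\<lambda>y. h y $ \<mu> $ \<nu>) differentiable (at x))"

lemma diff_tensorD: "diff_tensor h \<Longrightarrow> (\<lambda>y. h y $ \<mu> $ \<nu>) differentiable (at x)"
  by (simp add: diff_tensor_def)

lemma gdet_differentiable: "diff_tensor h \<Longrightarrow> (\<lambda>y. gdet k h y) differentiable (at x)"
  by (intro differentiable_det) (simp add: diff_tensorD)

lemma open_gdet_position: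
  assumes "diff_tensor h"
  shows "open {y. gdet k h y \<noteq> 0}"
proof -
  have "continuous_on UNIV (\<lambda>y. gdet k h y)"
    by (intro differentiable_imp_continuous_on differentiable_at_imp_differentiable_on
        gdet_differentiable[OF assms])
  then show ?thesis
    by (auto intro!: open_Collect_neq)
qed

lemma gdet_holomorphic: "(\<lambda>k. gdet k h x) holomorphic_on S"
  by (intro holomorphic_on_det) (auto intro!: holomorphic_intros)

lemma open_gdet_coupling: "open {k. gdet k h x \<noteq> 0}"
proof -
  have "continuous_on UNIV (\<lambda>k. gdet k h x)"
    by (intro holomorphic_on_imp_continuous_on gdet_holomorphic)
  then show ?thesis
    by (auto intro!: open_Collect_neq)
qed

lemma gdet_0: "gdet 0 h x \<noteq> 0"
proof -
  have "metric 0 h x = etaM"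
    by (simp add: vec_eq_iff)
  moreover have "invertible etaM"
    using etaM_etaM unfolding invertible_def by blast
  ultimately show ?thesis
    by (simp add: invertible_det_nz)
qed

lemma ginv_holomorphic:
  assumes "\<And>k. k \<in> S \<Longrightarrow> gdet k h x \<noteq> 0"
  shows "(\<lambda>k. ginv k h x $ i $ j) holomorphic_on S"
proof -
  have *: "(\<lambda>k. (\<chi> a b. if b = i then axis j 1 $ a else metric k h x $ a $ b) $ c $ e) holomorphic_on S" for c e
    by (cases "e = i") (auto intro!: holomorphic_intros)
  have "(\<lambda>k. det (\<chi> a b. if b = i then axis j 1 $ a else metric k h x $ a $ b) / gdet k h x) holomorphic_on S"
    using assms by (intro holomorphic_on_divide gdet_holomorphic holomorphic_on_det *) auto
  then show ?thesis
    by (rule holomorphic_transform) (simp add: assms matrix_inv_nth_cramer)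
qed

lemma ginv_differentiable:
  assumes h: "diff_tensor h" and d: "gdet k h x \<noteq> 0"
  shows "(\<lambda>y. ginv k h y $ i $ j) differentiable (at x)"
proof -
  let ?f = "\<lambda>y. det (\<chi> a b. if b = i then axis j 1 $ a else metric k h y $ a $ b) / gdet k h y"
  have *: "(\<lambda>y. (\<chi> a b. if b = i then axis j 1 $ a else metric k h y $ a $ b) $ c $ e) differentiable (at x)" for c e
    using h by (cases "e = i") (simp_all add: diff_tensorD)
  have "?f differentiable (at x)"
    using d by (intro differentiable_divide differentiable_det gdet_differentiable h *)
  then obtain f' where "(?f has_derivative f') (at x)"
    unfolding differentiable_def by blast
  then have "((\<lambda>y. ginv k h y $ i $ j) has_derivative f') (at x)"
    by (rule has_derivative_transform_within_open[OF _ open_gdet_position[OF h, of k]])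
       (simp_all add: d matrix_inv_nth_cramer)
  then show ?thesis
    unfolding differentiable_def by blast
qed

text \<open>Differentiating \<open>G ** g = mat 1\<close>, which holds near \<open>x\<close>, gives
  \<open>dG = - G dg G\<close>. The right-hand side involves \<open>G\<close> only at the point
  \<open>x\<close> itself, so its dependence on \<open>k\<close> is visible.\<close>

lemma partial_ginv:
  assumes h: "diff_tensor h" and d: "gdet k h x \<noteq> 0"
  shows "partial \<mu> (\<lambda>y. ginv k h y $ i $ j) x =
    - k * (\<Sum>a\<in>UNIV. \<Sum>b\<in>UNIV. ginv k h x $ i $ a * partial \<mu> (\<lambda>y. h y $ a $ b) x * ginv k h x $ b $ j)"
proof -
  let ?G = "ginv k h x"
  define D :: "complex ^ 4 ^ 4" where "D = (\<chi> i j. partial \<mu> (\<lambda>y. ginv k h y $ i $ j) x)"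
  define H :: "complex ^ 4 ^ 4" where "H = (\<chi> i j. partial \<mu> (\<lambda>y. metric k h y $ i $ j) x)"
  have H: "H $ a $ b = k * partial \<mu> (\<lambda>y. h y $ a $ b) x" for a b
    using h by (simp add: H_def partial_add partial_cmult diff_tensorD)
  have mdiff: "(\<lambda>y. metric k h y $ a $ b) differentiable (at x)" for a b
    using h by (simp add: diff_tensorD)
  have "D ** metric k h x + ?G ** H = 0"
  proof -
    have "(D ** metric k h x + ?G ** H) $ a $ b = 0" for a b
    proof -
      have "(D ** metric k h x + ?G ** H) $ a $ b =
          partial \<mu> (\<lambda>y. \<Sum>c\<in>UNIV. ginv k h y $ a $ c * metric k h y $ c $ b) x"
        by (subst partial_sum)
           (auto simp: partial_mult mdiff ginv_differentiable[OF h d] D_def H_def matrix_matrix_mult_def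
             sum.distrib simp del: metric_nth intro!: differentiable_mult)
      also have "\<dots> = partial \<mu> (\<lambda>y. (mat 1 :: complex ^ 4 ^ 4) $ a $ b) x"
        by (rule partial_cong_open[OF open_gdet_position[OF h, of k]])
           (use d matrix_inv_left in \<open>auto simp: matrix_matrix_mult_def vec_eq_iff simp del: metric_nth\<close>)
      finally show ?thesis by simp
    qed
    then show ?thesis by (simp add: vec_eq_iff)
  qed
  then have "(D ** metric k h x + ?G ** H) ** ?G = 0"
    by simp
  then have "D + ?G ** H ** ?G = 0"
    by (simp add: matrix_mult_add_rdistrib matrix_mul_assoc[symmetric] matrix_inv_right[OF d])
  then have "(D + ?G ** H ** ?G) $ i $ j = 0"
    by (simp only: zero_index)
  then have "D $ i $ j = - (?G ** H ** ?G) $ i $ j"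
    by (simp only: vector_add_component vector_uminus_component eq_neg_iff_add_eq_0)
  also have "(?G ** H ** ?G) $ i $ j = (\<Sum>b\<in>UNIV. \<Sum>a\<in>UNIV. ?G $ i $ a * H $ a $ b * ?G $ b $ j)"
    by (simp add: matrix_matrix_mult_def sum_distrib_right)
  also have "\<dots> = k * (\<Sum>a\<in>UNIV. \<Sum>b\<in>UNIV. ?G $ i $ a * partial \<mu> (\<lambda>y. h y $ a $ b) x * ?G $ b $ j)"
    by (subst sum.swap) (simp add: H sum_distrib_left mult_ac)
  finally show ?thesis
    by (simp add: D_def)
qed

section \<open>Expansion of the density in the coupling constant\<close>

definition Gamma_lin :: "tensor_field \<Rightarrow> 4 \<Rightarrow> 4 \<Rightarrow> 4 \<Rightarrow> real ^ 4 \<Rightarrow> complex" where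
  "Gamma_lin h \<mu> \<nu> \<rho> x =
     (partial \<mu> (\<lambda>y. h y $ \<nu> $ \<rho>) x + partial \<nu> (\<lambda>y. h y $ \<rho> $ \<mu>) x
      - partial \<rho> (\<lambda>y. h y $ \<mu> $ \<nu>) x) / 2"

text \<open>The constant \<eta> drops out under the derivative, so every Christoffel symbol carries
  exactly one explicit factor \<open>k\<close>. This is the source of the shift between the order of
  the density and the length of the chain.\<close>

lemma Gamma_low_eq: "diff_tensor h \<Longrightarrow> Gamma_low k h \<mu> \<nu> \<rho> x = k * Gamma_lin h \<mu> \<nu> \<rho> x"
  by (simp add: Gamma_low_def Gamma_lin_def partial_add partial_cmult diff_tensorD algebra_simps)

text \<open>
  \<open>\<eta> A\<^sub>4 \<eta> A\<^sub>5 \<eta> \<cdots> A\<^sub>j\<^sub>+\<^sub>3 \<eta>\<close>: numbering starts at 4 because the third particle supplies the Christoffel symbol.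
\<close>

primrec chain :: "(nat \<Rightarrow> complex ^ 4 ^ 4) \<Rightarrow> nat \<Rightarrow> complex ^ 4 ^ 4" where
  "chain A 0 = etaM"
| "chain A (Suc j) = chain A j ** A (j + 4) ** etaM"

lemma chain_differentiable:
  assumes "diff_tensor h"
  shows "(\<lambda>y. chain (\<lambda>_. h y) j $ a $ b) differentiable (at x)"
proof (induction j arbitrary: a b)
  case (Suc j)
  show ?case
    unfolding chain.simps matrix_matrix_mult_def vec_lambda_beta
    by (intro differentiable_sum ballI differentiable_mult Suc diff_tensorD[OF assms]) simp_all
qed simp

text \<open>Multiply \<open>(etaM + k h) G = 1\<close> by the chain from the left. Inserting
  \<open>etaM ** etaM = mat 1\<close> between \<open>h\<close> and \<open>G\<close> turns the
  product with \<open>h\<close> into the next chain, followed again by \<open>etaM ** G\<close>, so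
  the step can be iterated.\<close>

lemma chain_ginv:
  assumes "gdet k h x \<noteq> 0"
  shows "(chain (\<lambda>_. h x) j ** etaM ** ginv k h x) $ a $ b =
    chain (\<lambda>_. h x) j $ a $ b - k * (chain (\<lambda>_. h x) (Suc j) ** etaM ** ginv k h x) $ a $ b"
proof -
  let ?c = "chain (\<lambda>_. h x) j" and ?G = "ginv k h x"
  \<comment> \<open>The scalar matrix \<open>k * 1\<close> commutes with everything; with it the
    computation stays within the laws of matrix multiplication.\<close>
  define K :: "complex ^ 4 ^ 4" where "K = (\<chi> i j. if i = j then k else 0)"
  have K: "(K ** M) $ i $ j = k * M $ i $ j" for M :: "complex ^ 4 ^ 4" and i j
    by (simp add: matrix_matrix_mult_def K_def if_distrib[of "\<lambda>x. x * _"] cong: if_cong)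
  have KM: "K ** M = M ** K" for M :: "complex ^ 4 ^ 4"
    by (simp add: vec_eq_iff K)
       (simp add: matrix_matrix_mult_def K_def if_distrib[of "\<lambda>x. _ * x"] mult.commute cong: if_cong)
  have "metric k h x = etaM + K ** h x"
    by (simp add: vec_eq_iff K)
  then have "etaM ** ?G + K ** h x ** ?G = mat 1"
    using matrix_inv_right[OF assms] by (simp add: matrix_mult_add_rdistrib)
  then have "?c ** (etaM ** ?G + K ** h x ** ?G) = ?c"
    by simp
  then have "?c ** etaM ** ?G + ?c ** K ** h x ** ?G = ?c"
    by (simp add: matrix_add_ldistrib matrix_mul_assoc)
  moreover have "?c ** K ** h x ** ?G = K ** (?c ** h x ** etaM ** etaM ** ?G)"
    by (simp add: KM[of ?c, symmetric] matrix_mul_assoc[symmetric])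
       (simp add: matrix_mul_assoc[of etaM etaM] etaM_etaM)
  ultimately have "(?c ** etaM ** ?G) $ a $ b + (K ** (?c ** h x ** etaM ** etaM ** ?G)) $ a $ b = ?c $ a $ b"
    by (metis vector_add_component)
  then show ?thesis
    by (simp add: K algebra_simps)
qed

text \<open>Iterates \<open>chain_ginv\<close>, starting from
  \<open>G = chain _ 0 ** etaM ** G\<close>, where the chain of length 0 is
  \<open>etaM\<close>.\<close>

lemma ginv_expand:
  assumes "gdet k h x \<noteq> 0"
  shows "ginv k h x $ a $ b = (\<Sum>j<m. (- k) ^ j * chain (\<lambda>_. h x) j $ a $ b)
    + (- k) ^ m * (chain (\<lambda>_. h x) m ** etaM ** ginv k h x) $ a $ b"
proof (induction m)
  case 0
  show ?case by (simp add: etaM_etaM)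
next
  case (Suc m)
  then show ?case
    by (subst (asm) chain_ginv[OF assms]) (simp add: algebra_simps)
qed

lemma contr_differentiable:
  assumes "diff_tensor h" "gdet k h x \<noteq> 0" "\<And>\<nu> l. W \<nu> l differentiable (at x)"
  shows "(\<lambda>y. \<Sum>\<nu>\<in>UNIV. \<Sum>l\<in>UNIV. ginv k h y $ \<nu> $ l * W \<nu> l y) differentiable (at x)"
  by (intro differentiable_sum ballI differentiable_mult ginv_differentiable assms) simp_all

text \<open>The product rule and \<open>partial_ginv\<close> rewrite the derivative as a polynomial
  in \<open>k\<close> and the entries of the inverse metric at the fixed point \<open>x\<close>,
  with coefficients free of \<open>k\<close>.\<close>

lemma contr_holomorphic:
  assumes h: "diff_tensor h" and W: "\<And>\<nu> l. W \<nu> l differentiable (at x)"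
  shows "(\<lambda>k. partial \<mu> (\<lambda>y. \<Sum>\<nu>\<in>UNIV. \<Sum>l\<in>UNIV. ginv k h y $ \<nu> $ l * W \<nu> l y) x)
    holomorphic_on {k. gdet k h x \<noteq> 0}"
proof -
  let ?dG = "\<lambda>k i j. - k * (\<Sum>a\<in>UNIV. \<Sum>b\<in>UNIV. ginv k h x $ i $ a * partial \<mu> (\<lambda>y. h y $ a $ b) x * ginv k h x $ b $ j)"
  have "(\<lambda>k. \<Sum>\<nu>\<in>UNIV. \<Sum>l\<in>UNIV. ?dG k \<nu> l * W \<nu> l x + ginv k h x $ \<nu> $ l * partial \<mu> (W \<nu> l) x)
    holomorphic_on {k. gdet k h x \<noteq> 0}"
    by (intro holomorphic_intros ginv_holomorphic) auto
  then show ?thesis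
  proof (rule holomorphic_transform)
    fix k assume "k \<in> {k. gdet k h x \<noteq> 0}"
    then have d: "gdet k h x \<noteq> 0" by simp
    show "(\<Sum>\<nu>\<in>UNIV. \<Sum>l\<in>UNIV. ?dG k \<nu> l * W \<nu> l x + ginv k h x $ \<nu> $ l * partial \<mu> (W \<nu> l) x) =
      partial \<mu> (\<lambda>y. \<Sum>\<nu>\<in>UNIV. \<Sum>l\<in>UNIV. ginv k h y $ \<nu> $ l * W \<nu> l y) x"
      using ginv_differentiable[OF h d] W
      by (simp add: partial_sum partial_mult partial_ginv[OF h d])
  qed
qed

text \<open>The coefficient of \<open>(- k) ^ j\<close> in the contraction of the inverse metric
  with \<open>W\<close>.\<close>

definition chain_current ::
  "nat \<Rightarrow> tensor_field \<Rightarrow> (4 \<Rightarrow> 4 \<Rightarrow> real ^ 4 \<Rightarrow> complex) \<Rightarrow> real ^ 4 \<Rightarrow> complex" where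
  "chain_current j h W y = (\<Sum>\<nu>\<in>UNIV. \<Sum>l\<in>UNIV. chain (\<lambda>_. h y) j $ \<nu> $ l * W \<nu> l y)"

lemma chain_current_differentiable:
  assumes "diff_tensor h" "\<And>\<nu> l. W \<nu> l differentiable (at x)"
  shows "chain_current j h W differentiable (at x)"
  unfolding chain_current_def[abs_def]
  by (intro differentiable_sum ballI differentiable_mult chain_differentiable assms) simp_all

text \<open>The Neumann expansion holds on a neighbourhood of \<open>x\<close>, so it may be
  differentiated. The remainder is again the inverse metric contracted with differentiable weights,
  namely \<open>W\<close> multiplied by a chain; hence \<open>contr_holomorphic\<close> applies to
  it as well.\<close>

lemma partial_contr_expand:
  assumes h: "diff_tensor h" and W: "\<And>\<nu> l. W \<nu> l differentiable (at x)" and d: "gdet k h x \<noteq> 0"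
  shows "partial \<mu> (\<lambda>y. \<Sum>\<nu>\<in>UNIV. \<Sum>l\<in>UNIV. ginv k h y $ \<nu> $ l * W \<nu> l y) x =
    (\<Sum>j<m. (- k) ^ j * partial \<mu> (chain_current j h W) x) +
    (- k) ^ m * partial \<mu> (\<lambda>y. \<Sum>a\<in>UNIV. \<Sum>l\<in>UNIV. ginv k h y $ a $ l *
      (\<Sum>\<nu>\<in>UNIV. (chain (\<lambda>_. h y) m ** etaM) $ \<nu> $ a * W \<nu> l y)) x"
proof -
  let ?W = "\<lambda>a l y. \<Sum>\<nu>\<in>UNIV. (chain (\<lambda>_. h y) m ** etaM) $ \<nu> $ a * W \<nu> l y"
  have W': "?W a l differentiable (at x)" for a l
    unfolding matrix_matrix_mult_def vec_lambda_beta
    by (intro differentiable_sum ballI differentiable_mult chain_differentiable W h) simp_all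
  have "partial \<mu> (\<lambda>y. \<Sum>\<nu>\<in>UNIV. \<Sum>l\<in>UNIV. ginv k h y $ \<nu> $ l * W \<nu> l y) x =
    partial \<mu> (\<lambda>y. (\<Sum>j<m. (- k) ^ j * chain_current j h W y) +
      (- k) ^ m * (\<Sum>a\<in>UNIV. \<Sum>l\<in>UNIV. ginv k h y $ a $ l * ?W a l y)) x"
  proof (rule partial_cong_open[OF open_gdet_position[OF h, of k]])
    fix y assume "y \<in> {y. gdet k h y \<noteq> 0}"
    then have d': "gdet k h y \<noteq> 0" by simp
    let ?c = "\<lambda>j. chain (\<lambda>_. h y) j" and ?G = "ginv k h y"
    have "(\<Sum>\<nu>\<in>UNIV. \<Sum>l\<in>UNIV. ?G $ \<nu> $ l * W \<nu> l y) =
      (\<Sum>\<nu>\<in>UNIV. \<Sum>l\<in>UNIV. \<Sum>j<m. (- k) ^ j * (?c j $ \<nu> $ l * W \<nu> l y)) +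
      (- k) ^ m * (\<Sum>\<nu>\<in>UNIV. \<Sum>l\<in>UNIV. \<Sum>a\<in>UNIV. (?c m ** etaM) $ \<nu> $ a * ?G $ a $ l * W \<nu> l y)"
      by (subst ginv_expand[OF d', where m = m])
         (simp add: matrix_matrix_mult_def[of "?c m ** etaM"] sum_distrib_right sum_distrib_left
           distrib_right distrib_left sum.distrib mult_ac)
    also have "(\<Sum>\<nu>\<in>UNIV. \<Sum>l\<in>UNIV. \<Sum>j<m. (- k) ^ j * (?c j $ \<nu> $ l * W \<nu> l y)) =
        (\<Sum>j<m. (- k) ^ j * chain_current j h W y)"
      unfolding chain_current_def sum_distrib_left sum.swap[of _ "{..<m}" UNIV] ..
    also have "(\<Sum>\<nu>\<in>UNIV. \<Sum>l\<in>UNIV. \<Sum>a\<in>UNIV. (?c m ** etaM) $ \<nu> $ a * ?G $ a $ l * W \<nu> l y) =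
        (\<Sum>\<nu>\<in>UNIV. \<Sum>a\<in>UNIV. \<Sum>l\<in>UNIV. (?c m ** etaM) $ \<nu> $ a * ?G $ a $ l * W \<nu> l y)"
      by (intro sum.cong refl sum.swap)
    also have "\<dots> = (\<Sum>a\<in>UNIV. \<Sum>\<nu>\<in>UNIV. \<Sum>l\<in>UNIV. (?c m ** etaM) $ \<nu> $ a * ?G $ a $ l * W \<nu> l y)"
      by (rule sum.swap)
    also have "\<dots> = (\<Sum>a\<in>UNIV. \<Sum>l\<in>UNIV. \<Sum>\<nu>\<in>UNIV. (?c m ** etaM) $ \<nu> $ a * ?G $ a $ l * W \<nu> l y)"
      by (intro sum.cong refl sum.swap)
    also have "\<dots> = (\<Sum>a\<in>UNIV. \<Sum>l\<in>UNIV. ?G $ a $ l * ?W a l y)"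
      by (simp only: sum_distrib_left mult_ac)
    finally show "(\<Sum>\<nu>\<in>UNIV. \<Sum>l\<in>UNIV. ?G $ \<nu> $ l * W \<nu> l y) =
      (\<Sum>j<m. (- k) ^ j * chain_current j h W y) +
      (- k) ^ m * (\<Sum>a\<in>UNIV. \<Sum>l\<in>UNIV. ?G $ a $ l * ?W a l y)" .
  qed (use d in auto)
  also have "\<dots> = (\<Sum>j<m. (- k) ^ j * partial \<mu> (chain_current j h W) x) +
    (- k) ^ m * partial \<mu> (\<lambda>y. \<Sum>a\<in>UNIV. \<Sum>l\<in>UNIV. ginv k h y $ a $ l * ?W a l y) x"
    using contr_differentiable[OF h d, of ?W, OF W'] chain_current_differentiable[OF h W]
    by (subst partial_add) (auto simp: partial_cmult partial_sum intro!: differentiable_sum differentiable_mult)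
  finally show ?thesis .
qed

lemma contr_fps:
  assumes h: "diff_tensor h" and W: "\<And>\<nu> l. W \<nu> l differentiable (at x)"
  shows "fps_nth (fps_expansion (\<lambda>k. partial \<mu> (\<lambda>y. \<Sum>\<nu>\<in>UNIV. \<Sum>l\<in>UNIV. ginv k h y $ \<nu> $ l * W \<nu> l y) x) 0) j
    = (- 1) ^ j * partial \<mu> (chain_current j h W) x"
proof -
  let ?f = "\<lambda>k. partial \<mu> (\<lambda>y. \<Sum>\<nu>\<in>UNIV. \<Sum>l\<in>UNIV. ginv k h y $ \<nu> $ l * W \<nu> l y) x"
  let ?U = "{k. gdet k h x \<noteq> 0}"
  \<comment> \<open>One term beyond \<open>j\<close>: the remainder then starts at order
    \<open>j + 1\<close> and does not reach the coefficient in question.\<close>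
  let ?m = "Suc j"
  let ?W = "\<lambda>a l y. \<Sum>\<nu>\<in>UNIV. (chain (\<lambda>_. h y) ?m ** etaM) $ \<nu> $ a * W \<nu> l y"
  let ?g = "\<lambda>k. partial \<mu> (\<lambda>y. \<Sum>a\<in>UNIV. \<Sum>l\<in>UNIV. ginv k h y $ a $ l * ?W a l y) x"
  have W': "?W a l differentiable (at x)" for a l
    unfolding matrix_matrix_mult_def[of _ etaM] vec_lambda_beta
    by (intro differentiable_sum ballI differentiable_mult chain_differentiable W h) simp_all
  define c where "c = (\<lambda>i. partial \<mu> (chain_current i h W) x)"
  define F where "F = (\<Sum>i<?m. (- fps_X) ^ i * fps_const (c i)) + (- fps_X) ^ ?m * fps_expansion ?g 0"
  have U: "open ?U" "0 \<in> ?U"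
    using open_gdet_coupling gdet_0 by auto
  have g: "?g has_fps_expansion fps_expansion ?g 0"
    by (rule has_fps_expansion_fps_expansion[OF U]) (rule contr_holomorphic[OF h W'])
  have "(\<lambda>k. (\<Sum>i<?m. (- k) ^ i * c i) + (- k) ^ ?m * ?g k) has_fps_expansion F"
    unfolding F_def by (intro fps_expansion_intros g)
  moreover have "eventually (\<lambda>k. (\<Sum>i<?m. (- k) ^ i * c i) + (- k) ^ ?m * ?g k = ?f k) (nhds 0)"
    using eventually_nhds_in_open[OF U]
    by eventually_elim (subst partial_contr_expand[OF h W, where m = ?m], simp_all add: c_def)
  ultimately have "?f has_fps_expansion F"
    by (rule has_fps_expansion_cong[THEN iffD1, OF _ refl, rotated])
  then have "fps_expansion ?f 0 = F"
    by (rule fps_expansion_eqI)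
  also have "fps_nth F j = (- 1) ^ j * c j"
  proof -
    have *: "(- fps_X) ^ i = fps_const ((- 1) ^ i) * (fps_X ^ i :: complex fps)" for i
      by (metis fps_const_neg fps_const_1_eq_1 fps_const_power mult_minus1 power_mult_distrib)
    have "fps_nth F j = (\<Sum>i<?m. if i = j then (- 1) ^ j * c j else 0)"
      unfolding F_def fps_add_nth fps_sum_nth
      by (simp only: * mult.assoc fps_mult_left_const_nth fps_X_power_mult_nth)
         (auto simp: fps_const_def intro!: sum.cong)
    also have "\<dots> = (- 1) ^ j * c j"
      by (subst sum.delta) auto
    finally show ?thesis .
  qed
  finally show ?thesis
    by (simp add: c_def)
qed

definition ghost_source :: "tensor_field \<Rightarrow> covector_field \<Rightarrow> 4 \<Rightarrow> 4 \<Rightarrow> 4 \<Rightarrow> 4 \<Rightarrow> real ^ 4 \<Rightarrow> complex" where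
  "ghost_source h C \<rho> \<sigma> \<nu> l y = Gamma_lin h \<rho> \<sigma> l y * C y $ \<nu>"

text \<open>One regularity condition shared by complexified smooth fields and by complex plane
  waves, so that the expansion is proved once for both.\<close>

definition diff_fields :: "tensor_field \<Rightarrow> covector_field \<Rightarrow> bool" where
  "diff_fields h C \<longleftrightarrow> diff_tensor h \<and> (\<forall>\<mu> \<nu> \<rho> x. Gamma_lin h \<mu> \<nu> \<rho> differentiable (at x)) \<and>
     (\<forall>\<mu> x. (\<lambda>y. C y $ \<mu>) differentiable (at x))"

lemma ghost_source_differentiable:
  "diff_fields h C \<Longrightarrow> ghost_source h C \<rho> \<sigma> \<nu> l differentiable (at x)"
  unfolding ghost_source_def[abs_def] diff_fields_def by (intro differentiable_mult) auto

lemma partial_Gamma_up: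
  assumes "diff_fields h C" "gdet k h x \<noteq> 0"
  shows "partial \<mu> (\<lambda>y. \<Sum>\<nu>\<in>UNIV. Gamma_up k h \<nu> \<rho> \<sigma> y * C y $ \<nu>) x =
    k * partial \<mu> (\<lambda>y. \<Sum>\<nu>\<in>UNIV. \<Sum>l\<in>UNIV. ginv k h y $ \<nu> $ l * ghost_source h C \<rho> \<sigma> \<nu> l y) x"
proof -
  have h: "diff_tensor h"
    using assms by (simp add: diff_fields_def)
  have "(\<Sum>\<nu>\<in>UNIV. Gamma_up k h \<nu> \<rho> \<sigma> y * C y $ \<nu>) =
    k * (\<Sum>\<nu>\<in>UNIV. \<Sum>l\<in>UNIV. ginv k h y $ \<nu> $ l * ghost_source h C \<rho> \<sigma> \<nu> l y)" for y
    by (simp add: Gamma_up_def Gamma_low_eq[OF h] ghost_source_def sum_distrib_left sum_distrib_right mult_ac)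
  then show ?thesis
    by (simp add: partial_cmult contr_differentiable[OF h assms(2)] ghost_source_differentiable[OF assms(1)])
qed

definition contr_partial :: "tensor_field \<Rightarrow> covector_field \<Rightarrow> 4 \<Rightarrow> 4 \<Rightarrow> 4 \<Rightarrow> real ^ 4 \<Rightarrow> complex \<Rightarrow> complex" where
  "contr_partial h C \<mu> \<rho> \<sigma> x k =
     partial \<mu> (\<lambda>y. \<Sum>\<nu>\<in>UNIV. \<Sum>l\<in>UNIV. ginv k h y $ \<nu> $ l * ghost_source h C \<rho> \<sigma> \<nu> l y) x"

lemma contr_partial_holomorphic:
  "diff_fields h C \<Longrightarrow> contr_partial h C \<mu> \<rho> \<sigma> x holomorphic_on {k. gdet k h x \<noteq> 0}"
  unfolding contr_partial_def[abs_def]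
  by (rule contr_holomorphic) (auto simp: ghost_source_differentiable diff_fields_def)

abbreviation ghost_kinetic :: "real \<Rightarrow> covector_field \<Rightarrow> covector_field \<Rightarrow> real ^ 4 \<Rightarrow> complex" where
  "ghost_kinetic \<zeta> C Cb x \<equiv> - 1 / (2 * complex_of_real \<zeta>) *
       (\<Sum>\<rho>\<in>UNIV. \<Sum>\<sigma>\<in>UNIV. \<Sum>\<mu>\<in>UNIV.
          complex_of_real (eta \<rho> \<sigma>) * raise (Cb x) \<mu> * partial \<rho> (partial \<sigma> (\<lambda>y. C y $ \<mu>)) x)"

lemma ghost_lagrangian_eq:
  assumes "diff_fields h C" "gdet k h x \<noteq> 0"
  shows "ghost_lagrangian k \<zeta> h C Cb x = ghost_kinetic \<zeta> C Cb x - 1 / 2 *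
    (\<Sum>\<rho>\<in>UNIV. \<Sum>\<sigma>\<in>UNIV. \<Sum>\<mu>\<in>UNIV. complex_of_real (eta \<rho> \<sigma>) * raise (Cb x) \<mu> *
      (k * (contr_partial h C \<mu> \<rho> \<sigma> x k - 2 * contr_partial h C \<rho> \<mu> \<sigma> x k)))"
  unfolding ghost_lagrangian_def partial_Gamma_up[OF assms] contr_partial_def[symmetric]
  by (simp add: algebra_simps)

lemma ghost_lagrangian_holomorphic:
  assumes "diff_fields h C"
  shows "(\<lambda>k. ghost_lagrangian k \<zeta> h C Cb x) holomorphic_on {k. gdet k h x \<noteq> 0}"
proof -
  have "(\<lambda>k. ghost_kinetic \<zeta> C Cb x - 1 / 2 *
    (\<Sum>\<rho>\<in>UNIV. \<Sum>\<sigma>\<in>UNIV. \<Sum>\<mu>\<in>UNIV. complex_of_real (eta \<rho> \<sigma>) * raise (Cb x) \<mu> *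
      (k * (contr_partial h C \<mu> \<rho> \<sigma> x k - 2 * contr_partial h C \<rho> \<mu> \<sigma> x k))))
    holomorphic_on {k. gdet k h x \<noteq> 0}"
    by (intro holomorphic_on_diff holomorphic_on_mult holomorphic_on_sum holomorphic_on_const
        holomorphic_on_ident contr_partial_holomorphic assms)
  then show ?thesis
    by (rule holomorphic_transform) (simp add: ghost_lagrangian_eq[OF assms])
qed

text \<open>The kinetic term is constant in \<open>k\<close> and contributes to order 0 only. In the
  rest the factor \<open>k\<close> of the Christoffel symbol shifts the index, so order
  \<open>Suc j\<close> comes from chains with \<open>j\<close> copies of the field.\<close>

lemma ghost_lagrangian_fps:
  assumes "diff_fields h C"
  shows "fps_nth (fps_expansion (\<lambda>k. ghost_lagrangian k \<zeta> h C Cb x) 0) (Suc j) =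
    - 1 / 2 * (- 1) ^ j * (\<Sum>\<rho>\<in>UNIV. \<Sum>\<sigma>\<in>UNIV. \<Sum>\<mu>\<in>UNIV. complex_of_real (eta \<rho> \<sigma>) * raise (Cb x) \<mu> *
      (partial \<mu> (chain_current j h (ghost_source h C \<rho> \<sigma>)) x
       - 2 * partial \<rho> (chain_current j h (ghost_source h C \<mu> \<sigma>)) x))"
proof -
  let ?U = "{k. gdet k h x \<noteq> 0}"
  let ?e = "\<lambda>\<mu> \<rho> \<sigma>. fps_expansion (contr_partial h C \<mu> \<rho> \<sigma> x) 0"
  have h: "diff_tensor h"
    using assms by (simp add: diff_fields_def)
  have U: "open ?U" "0 \<in> ?U"
    using open_gdet_coupling gdet_0 by auto
  have e: "contr_partial h C \<mu> \<rho> \<sigma> x has_fps_expansion ?e \<mu> \<rho> \<sigma>" for \<mu> \<rho> \<sigma>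
    by (rule has_fps_expansion_fps_expansion[OF U]) (rule contr_partial_holomorphic[OF assms])
  have nth: "fps_nth (?e \<mu> \<rho> \<sigma>) j = (- 1) ^ j * partial \<mu> (chain_current j h (ghost_source h C \<rho> \<sigma>)) x" for \<mu> \<rho> \<sigma>
    unfolding contr_partial_def[abs_def]
    by (rule contr_fps[OF h ghost_source_differentiable[OF assms]])
  define F where "F = fps_const (ghost_kinetic \<zeta> C Cb x) - fps_const (1 / 2) *
    (\<Sum>\<rho>\<in>UNIV. \<Sum>\<sigma>\<in>UNIV. \<Sum>\<mu>\<in>UNIV. fps_const (complex_of_real (eta \<rho> \<sigma>) * raise (Cb x) \<mu>) *
      (fps_X * (?e \<mu> \<rho> \<sigma> - fps_const 2 * ?e \<rho> \<mu> \<sigma>)))"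
  have "(\<lambda>k. ghost_kinetic \<zeta> C Cb x - 1 / 2 *
    (\<Sum>\<rho>\<in>UNIV. \<Sum>\<sigma>\<in>UNIV. \<Sum>\<mu>\<in>UNIV. complex_of_real (eta \<rho> \<sigma>) * raise (Cb x) \<mu> *
      (k * (contr_partial h C \<mu> \<rho> \<sigma> x k - 2 * contr_partial h C \<rho> \<mu> \<sigma> x k)))) has_fps_expansion F"
    unfolding F_def
    by (intro has_fps_expansion_diff has_fps_expansion_mult has_fps_expansion_sum has_fps_expansion_const
        has_fps_expansion_fps_X e)
  moreover have "eventually (\<lambda>k. ghost_kinetic \<zeta> C Cb x - 1 / 2 *
    (\<Sum>\<rho>\<in>UNIV. \<Sum>\<sigma>\<in>UNIV. \<Sum>\<mu>\<in>UNIV. complex_of_real (eta \<rho> \<sigma>) * raise (Cb x) \<mu> *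
      (k * (contr_partial h C \<mu> \<rho> \<sigma> x k - 2 * contr_partial h C \<rho> \<mu> \<sigma> x k))) =
    ghost_lagrangian k \<zeta> h C Cb x) (nhds 0)"
    using eventually_nhds_in_open[OF U]
    by eventually_elim (simp add: ghost_lagrangian_eq[OF assms])
  ultimately have "(\<lambda>k. ghost_lagrangian k \<zeta> h C Cb x) has_fps_expansion F"
    by (rule has_fps_expansion_cong[THEN iffD1, OF _ refl, rotated])
  then have "fps_expansion (\<lambda>k. ghost_lagrangian k \<zeta> h C Cb x) 0 = F"
    by (rule fps_expansion_eqI)
  also have "fps_nth F (Suc j) = - 1 / 2 * (\<Sum>\<rho>\<in>UNIV. \<Sum>\<sigma>\<in>UNIV. \<Sum>\<mu>\<in>UNIV.
      complex_of_real (eta \<rho> \<sigma>) * raise (Cb x) \<mu> *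
      (fps_nth (?e \<mu> \<rho> \<sigma>) j - 2 * fps_nth (?e \<rho> \<mu> \<sigma>) j))"
    by (simp add: F_def fps_sum_nth del: fps_const_mult)
  also have "\<dots> = - 1 / 2 * (- 1) ^ j * (\<Sum>\<rho>\<in>UNIV. \<Sum>\<sigma>\<in>UNIV. \<Sum>\<mu>\<in>UNIV. complex_of_real (eta \<rho> \<sigma>) * raise (Cb x) \<mu> *
      (partial \<mu> (chain_current j h (ghost_source h C \<rho> \<sigma>)) x
       - 2 * partial \<rho> (chain_current j h (ghost_source h C \<mu> \<sigma>)) x))"
    by (simp add: nth sum_distrib_left algebra_simps)
  finally show ?thesis .
qed

text \<open>The coefficient of order 0 is the value at \<open>k = 0\<close>, where the metric is
  constant and all Christoffel symbols vanish.\<close>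

lemma ghost_order_0: "ghost_order 0 \<kappa> \<zeta> h C Cb x = ghost_kinetic \<zeta> C Cb x"
  by (simp add: ghost_order_def fps_expansion_def ghost_lagrangian_def Gamma_up_def Gamma_low_def)

section \<open>Convergence for a real symmetric field\<close>

lemma partial_linear_compose:
  assumes "f differentiable (at x)" "bounded_linear L"
  shows "partial \<mu> (\<lambda>y. L (f y)) x = L (partial \<mu> f x)"
proof -
  obtain f' where f': "(f has_derivative f') (at x)"
    using assms(1) unfolding differentiable_def by blast
  show ?thesis
    unfolding partial_eq[OF bounded_linear.has_derivative[OF assms(2) f']] by (simp add: partial_eq[OF f'])
qed

lemma differentiable_linear_compose:
  assumes "f differentiable (at x)" "bounded_linear L"
  shows "(\<lambda>y. L (f y)) differentiable (at x)"
  using assms bounded_linear.has_derivative unfolding differentiable_def by blast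

lemma bounded_linear_complex_entry: "bounded_linear (\<lambda>A :: real ^ 'n ^ 'm. complex_of_real (A $ \<mu> $ \<nu>))"
  by (intro bounded_linear_compose[OF bounded_linear_of_real] bounded_linear_compose[OF bounded_linear_vec_nth]
      bounded_linear_vec_nth)

lemma smooth_field_differentiable:
  assumes "smooth_field f"
  shows "f differentiable (at x)" "partial \<mu> f differentiable (at x)"
proof -
  \<comment> \<open>Two levels: the Christoffel symbols contain first derivatives of the metric and
    are differentiated once more.\<close>
  have "Ck_field (Suc (Suc 0)) f"
    using assms unfolding smooth_field_def by blast
  then show "f differentiable (at x)" "partial \<mu> f differentiable (at x)"
    by (auto simp: differentiable_on_def)
qed

lemma diff_fields_complexify:
  assumes h: "smooth_field h" and C: "smooth_field C"
  shows "diff_fields (complexify h) C"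
proof -
  have p: "partial \<mu> (\<lambda>y. complexify h y $ \<nu> $ \<rho>) x = complex_of_real (partial \<mu> h x $ \<nu> $ \<rho>)" for \<mu> \<nu> \<rho> x
    using partial_linear_compose[OF smooth_field_differentiable(1)[OF h] bounded_linear_complex_entry[of \<nu> \<rho>]]
    by (simp add: complexify_def)
  have d: "(\<lambda>y. complex_of_real (partial \<mu> h y $ \<nu> $ \<rho>)) differentiable (at x)" for \<mu> \<nu> \<rho> x
    by (rule differentiable_linear_compose[OF smooth_field_differentiable(2)[OF h] bounded_linear_complex_entry])
  have "diff_tensor (complexify h)"
    using differentiable_linear_compose[OF smooth_field_differentiable(1)[OF h] bounded_linear_complex_entry]
    by (simp add: diff_tensor_def complexify_def)
  moreover have "Gamma_lin (complexify h) \<mu> \<nu> \<rho> differentiable (at x)" for \<mu> \<nu> \<rho> x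
    unfolding Gamma_lin_def[abs_def] p
    by (intro differentiable_divide differentiable_diff differentiable_add d) simp_all
  moreover have "(\<lambda>y. C y $ \<mu>) differentiable (at x)" for \<mu> x
    by (rule differentiable_linear_compose[OF smooth_field_differentiable(1)[OF C] bounded_linear_vec_nth])
  ultimately show ?thesis
    by (simp add: diff_fields_def)
qed

text \<open>
  The operator norm \<open>M\<close> is attained at some unit vector \<open>u\<close>; there the positive
  semidefinite form of \<open>M\<^sup>2 - A\<^sup>2\<close> vanishes, whence \<open>(A - M) (A + M) u = 0\<close>.
\<close>

lemma symmetric_norm_eigenvalue:
  fixes A :: "real ^ 'n ^ 'n"
  assumes sym: "transpose A = A"
  obtains M where "M \<ge> 0" "\<And>v. norm (A *v v) \<le> M * norm v" "M \<in> EW A \<or> - M \<in> EW A"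
proof -
  have "continuous_on (sphere 0 1) (\<lambda>v. norm (A *v v))"
    by (intro continuous_on_norm linear_continuous_on matrix_vector_mul_bounded_linear)
  moreover have "compact (sphere (0 :: real ^ 'n) 1)" "sphere (0 :: real ^ 'n) 1 \<noteq> {}"
    by simp_all
  ultimately obtain u where u: "norm u = 1" and max: "\<And>v. norm v = 1 \<Longrightarrow> norm (A *v v) \<le> norm (A *v u)"
    using continuous_attains_sup[of "sphere 0 1" "\<lambda>v. norm (A *v v)"] by auto
  define M where "M = norm (A *v u)"
  have le: "norm (A *v v) \<le> M * norm v" for v
  proof (cases "v = 0")
    case False
    have "norm (A *v ((1 / norm v) *\<^sub>R v)) \<le> M"
      unfolding M_def by (rule max) (use False in simp)
    then show ?thesis
      using False by (simp add: matrix_vector_mult_scaleR divide_le_eq)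
  qed simp
  have adj: "(A *v v) \<bullet> w = v \<bullet> (A *v w)" for v w
    using dot_lmul_matrix[of v A w] sym by (metis transpose_matrix_vector)
  define z where "z = M\<^sup>2 *\<^sub>R u - A *v (A *v u)"
  define q where "q = (\<lambda>v. M\<^sup>2 * (v \<bullet> v) - (A *v v) \<bullet> (A *v v))"
  have q: "q v \<ge> 0" for v
  proof -
    have "(norm (A *v v))\<^sup>2 \<le> (M * norm v)\<^sup>2"
      by (rule power_mono[OF le]) simp
    then show ?thesis
      by (simp add: q_def power2_norm_eq_inner power_mult_distrib)
  qed
  have qu: "q u = 0"
    using u by (simp add: q_def M_def power2_norm_eq_inner norm_eq_1)
  have "q (u + t *\<^sub>R z) = 2 * t * (z \<bullet> z) + t\<^sup>2 * q z" for t
  proof -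
    have "q (u + t *\<^sub>R z) = q u + 2 * t * (M\<^sup>2 * (u \<bullet> z) - (A *v u) \<bullet> (A *v z)) + t\<^sup>2 * q z"
      by (simp add: q_def matrix_vector_right_distrib matrix_vector_mult_scaleR inner_add_left inner_add_right
          inner_commute power2_eq_square algebra_simps)
    moreover have "M\<^sup>2 * (u \<bullet> z) - (A *v u) \<bullet> (A *v z) = z \<bullet> z"
      by (simp add: z_def inner_diff_left adj[symmetric] flip: inner_scaleR_left)
    ultimately show ?thesis
      using qu by simp
  qed
  then have pos: "0 \<le> 2 * t * (z \<bullet> z) + t\<^sup>2 * q z" for t
    using q by metis
  have "z = 0"
  proof (rule ccontr)
    assume "z \<noteq> 0"
    then have zz: "z \<bullet> z > 0" by simp
    \<comment> \<open>Moving from \<open>u\<close> to \<open>u - t z\<close> changes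
      \<open>q\<close> by \<open>- t * (2 * (z \<bullet> z) - t * q z)\<close>. This choice gives
      \<open>t * q z \<le> z \<bullet> z\<close>, so the change is negative although
      \<open>q\<close> attains its minimum 0 at \<open>u\<close>. The 1 in the denominator covers
      \<open>q z = 0\<close>.\<close>
    define t where "t = (z \<bullet> z) / (q z + 1)"
    have t: "t > 0" using zz q[of z] by (simp add: t_def add_nonneg_pos)
    have "0 \<le> - t * (2 * (z \<bullet> z) - t * q z)"
      using pos[of "- t"] by (simp add: power2_eq_square algebra_simps)
    moreover have "t * q z \<le> z \<bullet> z"
      using q[of z] zz by (simp add: t_def field_simps)
    ultimately show False
      using t zz by (smt (verit) mult_neg_pos)
  qed
  define w where "w = A *v u + M *\<^sub>R u"
  have w: "A *v w = M *\<^sub>R w"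
    using \<open>z = 0\<close>
    by (simp add: w_def z_def matrix_vector_right_distrib matrix_vector_mult_scaleR power2_eq_square algebra_simps)
  have "M \<in> EW A \<or> - M \<in> EW A"
  proof (cases "w = 0")
    case True
    then have "A *v u = (- M) *\<^sub>R u"
      by (simp add: w_def eq_neg_iff_add_eq_0)
    moreover have "u \<noteq> 0" using u by auto
    ultimately show ?thesis by (auto simp: EW_def)
  next
    case False
    with w show ?thesis by (auto simp: EW_def)
  qed
  with le show ?thesis
    by (intro that[of M]) (simp_all add: M_def)
qed

text \<open>Carries the operator bound of a real matrix over to complex vectors, since such a matrix
  acts on real and imaginary parts separately.\<close>

lemma norm_complex_vec:
  fixes v :: "complex ^ 'n"
  shows "(norm v)\<^sup>2 = (norm (\<chi> i. Re (v $ i)))\<^sup>2 + (norm (\<chi> i. Im (v $ i)))\<^sup>2"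
  by (simp add: norm_vec_def L2_set_def sum_nonneg cmod_power2 sum.distrib)

text \<open>A kernel vector satisfies \<open>etaM v = - k H\<close> with \<open>H\<close> the image
  of \<open>v\<close> under the field. As \<eta> preserves the norm, \<open>norm v\<close> would be
  at most \<open>cmod k * M * norm v\<close>, which is smaller than \<open>norm v\<close>.\<close>

lemma gdet_complexify:
  assumes le: "\<And>v. norm (h x *v v) \<le> M * norm v" and "M \<ge> 0" and k: "cmod k * M < 1"
  shows "gdet k (complexify h) x \<noteq> 0"
proof
  assume "gdet k (complexify h) x = 0"
  then obtain v where v: "v \<noteq> 0" "metric k (complexify h) x *v v = 0"
    using invertible_det_nz matrix_left_invertible_ker[of "metric k (complexify h) x"]
    unfolding invertible_left_inverse by blast
  define H where "H = complexify h x *v v"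
  have "etaM *v v = - (k *s H)"
  proof -
    have "(metric k (complexify h) x *v v) $ i = (etaM *v v + k *s H) $ i" for i
      by (simp add: matrix_vector_mult_def H_def sum.distrib sum_distrib_left algebra_simps)
    then show ?thesis
      using v(2) by (simp add: vec_eq_iff eq_neg_iff_add_eq_0)
  qed
  moreover have "norm (etaM *v v) = norm v"
  proof -
    have "(etaM *v v) $ i = (if i = 0 then 1 else - 1) * v $ i" for i
      by (simp add: matrix_vector_mult_def eta_def if_distrib[of complex_of_real]
          if_distrib[of "\<lambda>x. x * _"] cong: if_cong)
    then have "norm ((etaM *v v) $ i) = norm (v $ i)" for i
      by simp
    then show ?thesis
      by (simp add: norm_vec_def)
  qed
  moreover have "norm (k *s H) = cmod k * norm H"
    by (simp add: norm_vec_def norm_mult L2_set_right_distrib)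
  ultimately have nv: "norm v = cmod k * norm H"
    by simp
  have "(norm H)\<^sup>2 \<le> (M * norm v)\<^sup>2"
  proof -
    let ?R = "\<chi> i. Re (v $ i)" and ?I = "\<chi> i. Im (v $ i)"
    have "(\<chi> i. Re (H $ i)) = h x *v ?R" "(\<chi> i. Im (H $ i)) = h x *v ?I"
      by (simp_all add: H_def matrix_vector_mult_def complexify_def vec_eq_iff)
    moreover have "(norm (h x *v w))\<^sup>2 \<le> M\<^sup>2 * (norm w)\<^sup>2" for w
      unfolding power_mult_distrib[symmetric] by (rule power_mono[OF le]) simp
    ultimately show ?thesis
      unfolding power_mult_distrib norm_complex_vec[of H] norm_complex_vec[of v] distrib_left
      by (metis add_mono)
  qed
  then have "norm H \<le> M * norm v"
    using \<open>M \<ge> 0\<close> power2_le_imp_le by fastforce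
  then have "norm v \<le> cmod k * M * norm v"
    using nv by (metis mult.assoc mult_left_mono norm_ge_zero)
  moreover have "norm v > 0"
    using v(1) by simp
  ultimately show False
    using k by (simp add: mult_less_cancel_right1 linorder_not_less[symmetric])
qed

lemma ghost_order_sums:
  assumes h: "smooth_field h" "transpose (h x) = h x"
    and ew: "\<And>l. l \<in> EW (h x) \<Longrightarrow> \<bar>\<kappa>\<bar> * \<bar>l\<bar> < 1"
    and C: "smooth_field C"
  shows "(\<lambda>m. ghost_order m \<kappa> \<zeta> (complexify h) C Cb x) sums
    ghost_lagrangian (complex_of_real \<kappa>) \<zeta> (complexify h) C Cb x"
proof -
  obtain M where M: "M \<ge> 0" "\<And>v. norm (h x *v v) \<le> M * norm v" "M \<in> EW (h x) \<or> - M \<in> EW (h x)"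
    using symmetric_norm_eigenvalue[OF h(2)] by metis
  have "\<bar>\<kappa>\<bar> * M < 1"
    using M(1,3) ew[of M] ew[of "- M"] by auto
  then have "\<bar>\<kappa>\<bar> * (M + 1) < \<bar>\<kappa>\<bar> + 1"
    by (simp add: algebra_simps)
  \<comment> \<open>The radius \<open>r = (\<bar>\<kappa>\<bar> + 1) / (M + 1)\<close> meets both
    demands, \<open>\<bar>\<kappa>\<bar> < r\<close> and \<open>r * M < 1\<close>; each is
    equivalent to \<open>\<bar>\<kappa>\<bar> * M < 1\<close>. Unlike \<open>1 / M\<close> it also
    makes sense for \<open>M = 0\<close>.\<close>
  then have \<kappa>: "\<bar>\<kappa>\<bar> < (\<bar>\<kappa>\<bar> + 1) / (M + 1)"
    using M(1) by (simp add: less_divide_eq)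
  have "gdet k (complexify h) x \<noteq> 0" if k: "k \<in> ball 0 ((\<bar>\<kappa>\<bar> + 1) / (M + 1))" for k
  proof (rule gdet_complexify[of h x M])
    show "norm (h x *v v) \<le> M * norm v" for v
      by (rule M(2))
    show "M \<ge> 0"
      by (rule M(1))
    have "cmod k * M \<le> (\<bar>\<kappa>\<bar> + 1) / (M + 1) * M"
      using k M(1) by (intro mult_right_mono) auto
    also have "\<dots> < 1"
      using \<open>\<bar>\<kappa>\<bar> * M < 1\<close> M(1) by (simp add: divide_less_eq algebra_simps)
    finally show "cmod k * M < 1" .
  qed
  then have "(\<lambda>k. ghost_lagrangian k \<zeta> (complexify h) C Cb x) holomorphic_on ball 0 ((\<bar>\<kappa>\<bar> + 1) / (M + 1))"
    by (intro holomorphic_on_subset[OF ghost_lagrangian_holomorphic[OF diff_fields_complexify[OF h(1) C]]]) auto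
  from holomorphic_power_series[OF this, of "complex_of_real \<kappa>"] \<kappa>
  show ?thesis
    by (simp add: ghost_order_def fps_expansion_def mult.commute)
qed

section \<open>Multilinear coefficients and uniqueness of the vertex\<close>

text \<open>Induction on the variables: with the others held fixed, the sum is a polynomial in
  \<open>v\<close> that vanishes identically, so each of its coefficients vanishes. The coefficient
  belonging to \<open>e m v\<close> is the sum over those monomials that share this exponent, and on
  these the exponents in \<open>V\<close> alone still tell monomials apart.\<close>

lemma polynomial_function_eq_0:
  fixes c :: "'m \<Rightarrow> complex" and e :: "'m \<Rightarrow> 'i \<Rightarrow> nat"
  assumes "finite V" "finite K"
    and "\<And>m m'. m \<in> K \<Longrightarrow> m' \<in> K \<Longrightarrow> (\<And>i. i \<in> V \<Longrightarrow> e m i = e m' i) \<Longrightarrow> m = m'"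
    and "\<And>\<epsilon>. (\<Sum>m\<in>K. c m * (\<Prod>i\<in>V. \<epsilon> i ^ e m i)) = 0"
    and "m \<in> K"
  shows "c m = 0"
  using assms
proof (induction V arbitrary: K rule: finite_induct)
  case empty
  then have "K = {m}" by auto
  then show ?case using empty.prems(3) by simp
next
  case (insert v V)
  define K' where "K' = {m' \<in> K. e m' v = e m v}"
  have "(\<Sum>m\<in>K'. c m * (\<Prod>i\<in>V. \<epsilon> i ^ e m i)) = 0" for \<epsilon>
  proof -
    define p where "p = (\<Sum>m\<in>K. Polynomial.monom (c m * (\<Prod>i\<in>V. \<epsilon> i ^ e m i)) (e m v))"
    have "poly p t = 0" for t
    proof -
      have "poly p t = (\<Sum>m\<in>K. c m * (\<Prod>i\<in>insert v V. (\<epsilon>(v := t)) i ^ e m i))"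
        unfolding p_def poly_sum poly_monom
      proof (intro sum.cong refl)
        fix m
        have "(\<Prod>i\<in>V. (\<epsilon>(v := t)) i ^ e m i) = (\<Prod>i\<in>V. \<epsilon> i ^ e m i)"
          by (intro prod.cong) (use insert.hyps in auto)
        then show "c m * (\<Prod>i\<in>V. \<epsilon> i ^ e m i) * t ^ e m v = c m * (\<Prod>i\<in>insert v V. (\<epsilon>(v := t)) i ^ e m i)"
          using insert.hyps by simp
      qed
      then show ?thesis using insert.prems(3) by simp
    qed
    then have "p = 0"
      using poly_all_0_iff_0 by blast
    then have "coeff p (e m v) = 0" by simp
    also have "coeff p (e m v) = (\<Sum>m'\<in>K. if e m' v = e m v then c m' * (\<Prod>i\<in>V. \<epsilon> i ^ e m' i) else 0)"
      by (simp add: p_def coeff_sum)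
    also have "\<dots> = (\<Sum>m\<in>K'. c m * (\<Prod>i\<in>V. \<epsilon> i ^ e m i))"
      unfolding K'_def using insert.prems(1) by (intro sum.inter_filter[symmetric])
    finally show ?thesis .
  qed
  moreover have "finite K'" "m \<in> K'"
    using insert.prems by (auto simp: K'_def)
  moreover have "m1 = m2" if "m1 \<in> K'" "m2 \<in> K'" "\<And>i. i \<in> V \<Longrightarrow> e m1 i = e m2 i" for m1 m2
    by (rule insert.prems(2)) (use that in \<open>auto simp: K'_def\<close>)
  ultimately show ?case
    using insert.IH by blast
qed

definition monom_eval :: "(nat \<Rightarrow> complex) \<Rightarrow> (nat \<Rightarrow>\<^sub>0 nat) \<Rightarrow> complex" where
  "monom_eval \<epsilon> m = (\<Prod>i\<in>Poly_Mapping.keys m. \<epsilon> i ^ Poly_Mapping.lookup m i)"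

definition poly_eval :: "(nat \<Rightarrow> complex) \<Rightarrow> ((nat \<Rightarrow>\<^sub>0 nat) \<Rightarrow>\<^sub>0 complex) \<Rightarrow> complex" where
  "poly_eval \<epsilon> P = (\<Sum>m\<in>Poly_Mapping.keys P. Poly_Mapping.lookup P m * monom_eval \<epsilon> m)"

text \<open>Different monomials have different sets of keys; a common finite range of indices is
  what allows them to be added and compared.\<close>

lemma monom_eval_superset:
  "finite V \<Longrightarrow> Poly_Mapping.keys m \<subseteq> V \<Longrightarrow> monom_eval \<epsilon> m = (\<Prod>i\<in>V. \<epsilon> i ^ Poly_Mapping.lookup m i)"
  unfolding monom_eval_def by (rule prod.mono_neutral_left) (auto simp: in_keys_iff)

lemma poly_eval_superset:
  "finite K \<Longrightarrow> Poly_Mapping.keys P \<subseteq> K \<Longrightarrow> poly_eval \<epsilon> P = (\<Sum>m\<in>K. Poly_Mapping.lookup P m * monom_eval \<epsilon> m)"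
  unfolding poly_eval_def by (rule sum.mono_neutral_left) (auto simp: in_keys_iff)

lemma monom_eval_add: "monom_eval \<epsilon> (m + m') = monom_eval \<epsilon> m * monom_eval \<epsilon> m'"
proof -
  let ?V = "Poly_Mapping.keys m \<union> Poly_Mapping.keys m'"
  have "Poly_Mapping.keys (m + m') \<subseteq> ?V"
    by (rule Poly_Mapping.keys_add)
  then show ?thesis
    by (simp add: monom_eval_superset[of ?V] lookup_add power_add prod.distrib)
qed

lemma monom_eval_sum_single: "monom_eval \<epsilon> (\<Sum>i\<in>I. Poly_Mapping.single (f i) 1) = (\<Prod>i\<in>I. \<epsilon> (f i))"
proof (induction I rule: infinite_finite_induct)
  case (insert i I)
  moreover have "monom_eval \<epsilon> (Poly_Mapping.single (f i) 1) = \<epsilon> (f i)"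
    by (simp add: monom_eval_def)
  ultimately show ?case
    by (simp add: monom_eval_add)
qed (simp_all add: monom_eval_def)

lemma poly_eval_add: "poly_eval \<epsilon> (P + P') = poly_eval \<epsilon> P + poly_eval \<epsilon> P'"
proof -
  let ?K = "Poly_Mapping.keys P \<union> Poly_Mapping.keys P'"
  have "Poly_Mapping.keys (P + P') \<subseteq> ?K"
    by (rule Poly_Mapping.keys_add)
  then show ?thesis
    by (simp add: poly_eval_superset[of ?K] lookup_add distrib_right sum.distrib)
qed

lemma poly_eval_uminus: "poly_eval \<epsilon> (- P) = - poly_eval \<epsilon> P"
  by (simp add: poly_eval_def sum_negf)

lemma poly_eval_sum: "poly_eval \<epsilon> (\<Sum>i\<in>I. P i) = (\<Sum>i\<in>I. poly_eval \<epsilon> (P i))"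
  by (induction I rule: infinite_finite_induct) (simp_all add: poly_eval_add, simp_all add: poly_eval_def)

lemma poly_eval_single: "poly_eval \<epsilon> (Poly_Mapping.single m c) = c * monom_eval \<epsilon> m"
  by (simp add: poly_eval_def)

text \<open>Only finitely many variables occur in the monomials of the difference, and outside them
  all exponents are 0. Hence the statement for finitely many variables applies.\<close>

lemma poly_eval_inject:
  assumes "\<And>\<epsilon>. poly_eval \<epsilon> P = poly_eval \<epsilon> P'"
  shows "P = P'"
proof -
  let ?K = "Poly_Mapping.keys (P - P')"
  let ?V = "\<Union>m\<in>?K. Poly_Mapping.keys m"
  have "Poly_Mapping.lookup (P - P') m = 0" if "m \<in> ?K" for m
  proof (rule polynomial_function_eq_0[where V = ?V and K = ?K and e = Poly_Mapping.lookup])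
    show "m = m'" if "m \<in> ?K" "m' \<in> ?K"
      "\<And>i. i \<in> ?V \<Longrightarrow> Poly_Mapping.lookup m i = Poly_Mapping.lookup m' i" for m m'
    proof (rule poly_mapping_eqI)
      fix i
      show "Poly_Mapping.lookup m i = Poly_Mapping.lookup m' i"
      proof (cases "i \<in> ?V")
        case False
        then have "i \<notin> Poly_Mapping.keys m" "i \<notin> Poly_Mapping.keys m'"
          using that by blast+
        then show ?thesis by (simp add: in_keys_iff)
      qed (rule that(3))
    qed
    fix \<epsilon>
    have "(\<Sum>m\<in>?K. Poly_Mapping.lookup (P - P') m * (\<Prod>i\<in>?V. \<epsilon> i ^ Poly_Mapping.lookup m i)) = poly_eval \<epsilon> (P - P')"
      unfolding poly_eval_def by (intro sum.cong refl) (subst monom_eval_superset[of ?V]; auto)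
    also have "\<dots> = 0"
      using poly_eval_add[of \<epsilon> P "- P'"] assms by (simp add: poly_eval_uminus)
    finally show "(\<Sum>m\<in>?K. Poly_Mapping.lookup (P - P') m * (\<Prod>i\<in>?V. \<epsilon> i ^ Poly_Mapping.lookup m i)) = 0" .
  qed (use that in auto)
  then have "m \<notin> ?K" for m
    by (metis in_keys_iff)
  then have "?K = {}"
    by blast
  then have "P - P' = 0"
    by (simp only: keys_eq_empty)
  then show ?thesis by simp
qed

lemma has_multilinear_coeff_alt:
  "has_multilinear_coeff F I Q \<longleftrightarrow>
    (\<exists>P. F = (\<lambda>\<epsilon>. poly_eval \<epsilon> P) \<and> Q = Poly_Mapping.lookup P (\<Sum>i\<in>I. Poly_Mapping.single i 1))"
  unfolding has_multilinear_coeff_def poly_eval_def monom_eval_def by (simp add: fun_eq_iff)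

lemma has_multilinear_coeff_unique:
  assumes "has_multilinear_coeff F I Q" "has_multilinear_coeff F I Q'"
  shows "Q = Q'"
proof -
  obtain P P' where P: "F = (\<lambda>\<epsilon>. poly_eval \<epsilon> P)" "Q = Poly_Mapping.lookup P (\<Sum>i\<in>I. Poly_Mapping.single i 1)"
    and P': "F = (\<lambda>\<epsilon>. poly_eval \<epsilon> P')" "Q' = Poly_Mapping.lookup P' (\<Sum>i\<in>I. Poly_Mapping.single i 1)"
    using assms unfolding has_multilinear_coeff_alt by blast
  have "P = P'"
    by (rule poly_eval_inject) (metis P(1) P'(1))
  then show ?thesis using P(2) P'(2) by simp
qed

text \<open>Comparing exponents, every index of \<open>I\<close> must be hit by \<open>f\<close>; a
  surjection of a finite set onto itself is a bijection.\<close>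

lemma sum_single_eq_iff:
  assumes "finite I" "f ` I \<subseteq> I"
  shows "(\<Sum>i\<in>I. Poly_Mapping.single (f i) (1::nat)) = (\<Sum>i\<in>I. Poly_Mapping.single i 1) \<longleftrightarrow> bij_betw f I I"
proof
  assume "bij_betw f I I"
  then show "(\<Sum>i\<in>I. Poly_Mapping.single (f i) (1::nat)) = (\<Sum>i\<in>I. Poly_Mapping.single i 1)"
    by (rule sum.reindex_bij_betw)
next
  assume eq: "(\<Sum>i\<in>I. Poly_Mapping.single (f i) (1::nat)) = (\<Sum>i\<in>I. Poly_Mapping.single i 1)"
  have "I \<subseteq> f ` I"
  proof
    fix j assume "j \<in> I"
    have "(\<Sum>i\<in>I. if f i = j then 1 else 0) = (\<Sum>i\<in>I. if i = j then 1 else (0::nat))"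
      using arg_cong[OF eq, of "\<lambda>m. Poly_Mapping.lookup m j"]
      by (simp add: lookup_sum lookup_single when_def flip: One_nat_def)
    also have "\<dots> = 1"
      using \<open>j \<in> I\<close> assms(1) by simp
    finally have "(\<Sum>i\<in>I. if f i = j then 1 else 0) \<noteq> (0::nat)"
      by simp
    then obtain i where "i \<in> I" "(if f i = j then 1 else 0) \<noteq> (0::nat)"
      by (rule sum.not_neutral_contains_not_neutral)
    then show "j \<in> f ` I" by (auto split: if_splits)
  qed
  then have "f ` I = I"
    using assms(2) by auto
  then show "bij_betw f I I"
    using assms(1) by (simp add: bij_betw_def eq_card_imp_inj_on)
qed

lemma has_multilinear_coeff_PiE:
  fixes I :: "nat set"
  assumes "finite I" "F = (\<lambda>\<epsilon>. \<Sum>f\<in>I \<rightarrow>\<^sub>E I. K f * (\<Prod>i\<in>I. \<epsilon> (f i)))"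
  shows "has_multilinear_coeff F I (\<Sum>f\<in>{f \<in> I \<rightarrow>\<^sub>E I. bij_betw f I I}. K f)"
proof -
  let ?m = "\<lambda>f :: nat \<Rightarrow> nat. \<Sum>i\<in>I. Poly_Mapping.single (f i) (1 :: nat)"
  define P where "P = (\<Sum>f\<in>I \<rightarrow>\<^sub>E I. Poly_Mapping.single (?m f) (K f))"
  have fin: "finite (I \<rightarrow>\<^sub>E I)"
    using assms(1) by (simp add: finite_PiE)
  have "F = (\<lambda>\<epsilon>. poly_eval \<epsilon> P)"
    unfolding assms(2) by (simp add: P_def poly_eval_sum poly_eval_single monom_eval_sum_single flip: One_nat_def)
  moreover have "Poly_Mapping.lookup P (\<Sum>i\<in>I. Poly_Mapping.single i 1) = (\<Sum>f\<in>{f \<in> I \<rightarrow>\<^sub>E I. bij_betw f I I}. K f)"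
  proof -
    have "Poly_Mapping.lookup P (\<Sum>i\<in>I. Poly_Mapping.single i 1) =
      (\<Sum>f\<in>I \<rightarrow>\<^sub>E I. if ?m f = (\<Sum>i\<in>I. Poly_Mapping.single i 1) then K f else 0)"
      by (simp add: P_def lookup_sum lookup_single when_def)
    also have "\<dots> = (\<Sum>f\<in>I \<rightarrow>\<^sub>E I. if bij_betw f I I then K f else 0)"
      by (intro sum.cong refl) (subst sum_single_eq_iff[OF assms(1)]; auto)
    also have "\<dots> = (\<Sum>f\<in>{f \<in> I \<rightarrow>\<^sub>E I. bij_betw f I I}. K f)"
      using fin by (intro sum.inter_filter[symmetric])
    finally show ?thesis .
  qed
  ultimately show ?thesis
    unfolding has_multilinear_coeff_alt by (intro exI[of _ P] conjI) (simp_all only:)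
qed

text \<open>The two index sets differ only in convention: outside \<open>I\<close>, members of
  \<open>PiE\<close> are undefined while permutations are the identity. \<open>K\<close> does not
  look there.\<close>

lemma sum_bij_PiE_permutes:
  assumes "\<And>f g. (\<And>i. i \<in> I \<Longrightarrow> f i = g i) \<Longrightarrow> K f = K g"
  shows "(\<Sum>f\<in>{f \<in> I \<rightarrow>\<^sub>E I. bij_betw f I I}. K f) = (\<Sum>s | s permutes I. K s)"
proof (rule sum.reindex_bij_witness[where i = "\<lambda>s. restrict s I" and j = "\<lambda>f i. if i \<in> I then f i else i"])
  fix f assume f: "f \<in> {f \<in> I \<rightarrow>\<^sub>E I. bij_betw f I I}"
  show "restrict (\<lambda>i. if i \<in> I then f i else i) I = f"
    using f by (auto simp: fun_eq_iff PiE_def extensional_def)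
  have "bij_betw (\<lambda>i. if i \<in> I then f i else i) I I"
    using f by (auto cong: bij_betw_cong)
  then show "(\<lambda>i. if i \<in> I then f i else i) \<in> {s. s permutes I}"
    by (auto intro: bij_imp_permutes)
  show "K (\<lambda>i. if i \<in> I then f i else i) = K f"
    by (rule assms) simp
next
  fix s assume s: "s \<in> {s. s permutes I}"
  then have "s permutes I" by simp
  then show "(\<lambda>i. if i \<in> I then restrict s I i else i) = s"
    by (auto simp: fun_eq_iff permutes_not_in)
  show "restrict s I \<in> {f \<in> I \<rightarrow>\<^sub>E I. bij_betw f I I}"
    using \<open>s permutes I\<close> by (auto simp: permutes_in_image permutes_imp_bij cong: bij_betw_cong)
qed

section \<open>Recovering a pair symmetric tensor from its contractions\<close>

lemma swap_at_insert: "i \<notin> S \<Longrightarrow> swap_at (insert i S) \<mu> \<nu> = (swap_at S \<mu> \<nu>)(i := swap_at S \<nu> \<mu> i)"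
  by (auto simp: swap_at_def fun_eq_iff)

lemma pair_symmetric_swap_at:
  assumes T: "pair_symmetric n T" and "S \<subseteq> {3..n}"
  shows "T \<rho>1 \<rho>2 (swap_at S \<mu> \<nu>) (swap_at S \<nu> \<mu>) = T \<rho>1 \<rho>2 \<mu> \<nu>"
proof -
  have "finite S"
    using assms(2) finite_subset by blast
  then show ?thesis
    using assms(2)
  proof (induction S rule: finite_induct)
    case empty
    show ?case by (simp add: swap_at_def[abs_def])
  next
    case (insert i S)
    have "T \<rho>1 \<rho>2 (swap_at (insert i S) \<mu> \<nu>) (swap_at (insert i S) \<nu> \<mu>) = T \<rho>1 \<rho>2 (swap_at S \<mu> \<nu>) (swap_at S \<nu> \<mu>)"
      unfolding swap_at_insert[OF insert.hyps(2)]
      using T insert.prems unfolding pair_symmetric_def by blast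
    then show ?case
      using insert by simp
  qed
qed

text \<open>The symmetric part of a matrix unit, hence an admissible graviton amplitude. For
  \<open>\<alpha> = \<beta>\<close> both indicators coincide and the entry is 1.\<close>

definition sym_unit :: "4 \<Rightarrow> 4 \<Rightarrow> complex ^ 4 ^ 4" where
  "sym_unit \<alpha> \<beta> = (\<chi> \<mu> \<nu>. (of_bool (\<mu> = \<beta> \<and> \<nu> = \<alpha>) + of_bool (\<mu> = \<alpha> \<and> \<nu> = \<beta>)) / 2)"

lemma transpose_sym_unit: "transpose (sym_unit \<alpha> \<beta>) = sym_unit \<alpha> \<beta>"
  by (simp add: vec_eq_iff transpose_def sym_unit_def conj_commute add.commute)

text \<open>Multiplying out the binomials, \<open>S\<close> records the positions at which the
  exchanged term was chosen.\<close>

lemma prod_sym_unit: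
  assumes "finite I"
  shows "(\<Prod>i\<in>I. sym_unit (\<alpha> i) (\<beta> i) $ \<mu> i $ \<nu> i) =
    (\<Sum>S\<in>Pow I. of_bool (\<forall>i\<in>I. \<mu> i = swap_at S \<alpha> \<beta> i \<and> \<nu> i = swap_at S \<beta> \<alpha> i)) / 2 ^ card I"
proof -
  have ob: "(\<Prod>i\<in>J. of_bool (P i)) = (of_bool (\<forall>i\<in>J. P i) :: complex)" if "finite J" for J and P :: "'a \<Rightarrow> bool"
    using that by (induction J rule: finite_induct) auto
  have "(\<Prod>i\<in>I. sym_unit (\<alpha> i) (\<beta> i) $ \<mu> i $ \<nu> i) =
    (\<Prod>i\<in>I. of_bool (\<mu> i = \<beta> i \<and> \<nu> i = \<alpha> i) + of_bool (\<mu> i = \<alpha> i \<and> \<nu> i = \<beta> i)) / 2 ^ card I"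
    by (simp add: sym_unit_def prod_dividef)
  also have "(\<Prod>i\<in>I. of_bool (\<mu> i = \<beta> i \<and> \<nu> i = \<alpha> i) + of_bool (\<mu> i = \<alpha> i \<and> \<nu> i = \<beta> i)) =
    (\<Sum>S\<in>Pow I. (\<Prod>i\<in>S. of_bool (\<mu> i = \<beta> i \<and> \<nu> i = \<alpha> i)) *
       (\<Prod>i\<in>I - S. of_bool (\<mu> i = \<alpha> i \<and> \<nu> i = \<beta> i)) :: complex)"
    by (rule prod_add[OF assms])
  also have "\<dots> = (\<Sum>S\<in>Pow I. of_bool (\<forall>i\<in>I. \<mu> i = swap_at S \<alpha> \<beta> i \<and> \<nu> i = swap_at S \<beta> \<alpha> i))"
  proof (intro sum.cong refl)
    fix S assume "S \<in> Pow I"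
    then have "finite S" "finite (I - S)" "S \<subseteq> I"
      using assms finite_subset by auto
    moreover have "(\<forall>i\<in>S. \<mu> i = \<beta> i \<and> \<nu> i = \<alpha> i) \<and> (\<forall>i\<in>I - S. \<mu> i = \<alpha> i \<and> \<nu> i = \<beta> i) \<longleftrightarrow>
        (\<forall>i\<in>I. \<mu> i = swap_at S \<alpha> \<beta> i \<and> \<nu> i = swap_at S \<beta> \<alpha> i)"
      using \<open>S \<subseteq> I\<close> by (auto simp: swap_at_def split: if_splits)
    ultimately show "(\<Prod>i\<in>S. of_bool (\<mu> i = \<beta> i \<and> \<nu> i = \<alpha> i)) * (\<Prod>i\<in>I - S. of_bool (\<mu> i = \<alpha> i \<and> \<nu> i = \<beta> i)) =
        (of_bool (\<forall>i\<in>I. \<mu> i = swap_at S \<alpha> \<beta> i \<and> \<nu> i = swap_at S \<beta> \<alpha> i) :: complex)"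
      by (simp add: ob flip: of_bool_conj)
  qed
  finally show ?thesis .
qed

text \<open>Each of the \<open>2 ^ card\<close> exchange patterns picks out one component of
  \<open>T\<close>, and by pair symmetry all of them are equal, so the denominator cancels.\<close>

lemma contract_sym_unit:
  assumes T: "is_vertex_tensor n T" "pair_symmetric n T"
  shows "contract n T (axis \<rho>1 1) (axis \<rho>2 1) (\<lambda>i. sym_unit (\<alpha> i) (\<beta> i)) = T \<rho>1 \<rho>2 \<alpha> \<beta>"
proof -
  let ?I = "{3..n}" and ?P = "{3..n} \<rightarrow>\<^sub>E (UNIV :: 4 set)"
  let ?b = "\<lambda>S \<mu> \<nu>. of_bool (\<forall>i\<in>?I. \<mu> i = swap_at S \<alpha> \<beta> i \<and> \<nu> i = swap_at S \<beta> \<alpha> i) :: complex"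
  have fin: "finite ?P"
    by (simp add: finite_PiE)
  have one: "(\<Sum>\<mu>\<in>?P. \<Sum>\<nu>\<in>?P. T \<rho>1 \<rho>2 \<mu> \<nu> * ?b S \<mu> \<nu>) = T \<rho>1 \<rho>2 \<alpha> \<beta>" if S: "S \<in> Pow ?I" for S
  proof -
    \<comment> \<open>Members of \<open>?P\<close> are undefined outside \<open>?I\<close>, so the
      indicator selects these restrictions; that \<open>T\<close> ignores values outside
      \<open>?I\<close> removes them afterwards.\<close>
    let ?\<mu> = "restrict (swap_at S \<alpha> \<beta>) ?I" and ?\<nu> = "restrict (swap_at S \<beta> \<alpha>) ?I"
    have b: "?b S \<mu> \<nu> = (if \<nu> = ?\<nu> then if \<mu> = ?\<mu> then 1 else 0 else 0)" if "\<mu> \<in> ?P" "\<nu> \<in> ?P" for \<mu> \<nu>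
      using that by (auto simp: PiE_def extensional_def fun_eq_iff)
    have mem: "?\<mu> \<in> ?P" "?\<nu> \<in> ?P"
      by auto
    have "(\<Sum>\<mu>\<in>?P. \<Sum>\<nu>\<in>?P. T \<rho>1 \<rho>2 \<mu> \<nu> * ?b S \<mu> \<nu>) =
      (\<Sum>\<mu>\<in>?P. \<Sum>\<nu>\<in>?P. if \<nu> = ?\<nu> then if \<mu> = ?\<mu> then T \<rho>1 \<rho>2 \<mu> \<nu> else 0 else 0)"
    proof (intro sum.cong refl)
      fix \<mu> \<nu> assume "\<mu> \<in> ?P" "\<nu> \<in> ?P"
      from b[OF this] show "T \<rho>1 \<rho>2 \<mu> \<nu> * ?b S \<mu> \<nu> =
          (if \<nu> = ?\<nu> then if \<mu> = ?\<mu> then T \<rho>1 \<rho>2 \<mu> \<nu> else 0 else 0)"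
        by (simp only:) (simp only: if_distrib[of "\<lambda>x. T _ _ _ _ * x"] mult_1_right mult_zero_right)
    qed
    also have "\<dots> = T \<rho>1 \<rho>2 ?\<mu> ?\<nu>"
      using mem by (simp only: sum.delta[OF fin] if_True)
    also have "\<dots> = T \<rho>1 \<rho>2 (swap_at S \<alpha> \<beta>) (swap_at S \<beta> \<alpha>)"
      using T(1) unfolding is_vertex_tensor_def by (metis restrict_apply')
    also have "\<dots> = T \<rho>1 \<rho>2 \<alpha> \<beta>"
      using S by (intro pair_symmetric_swap_at[OF T(2)]) auto
    finally show ?thesis .
  qed
  have "contract n T (axis \<rho>1 1) (axis \<rho>2 1) (\<lambda>i. sym_unit (\<alpha> i) (\<beta> i)) =
    (\<Sum>r1\<in>UNIV. \<Sum>r2\<in>UNIV. if r2 = \<rho>2 then if r1 = \<rho>1 then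
      (\<Sum>\<mu>\<in>?P. \<Sum>\<nu>\<in>?P. T r1 r2 \<mu> \<nu> * (\<Prod>i=3..n. sym_unit (\<alpha> i) (\<beta> i) $ \<mu> i $ \<nu> i)) else 0 else 0)"
    unfolding contract_def by (intro sum.cong refl) (auto simp: axis_def)
  also have "\<dots> = (\<Sum>\<mu>\<in>?P. \<Sum>\<nu>\<in>?P. T \<rho>1 \<rho>2 \<mu> \<nu> * (\<Prod>i=3..n. sym_unit (\<alpha> i) (\<beta> i) $ \<mu> i $ \<nu> i))"
    by simp
  also have "\<dots> = (\<Sum>S\<in>Pow ?I. (\<Sum>\<mu>\<in>?P. \<Sum>\<nu>\<in>?P. T \<rho>1 \<rho>2 \<mu> \<nu> * ?b S \<mu> \<nu>)) / 2 ^ card ?I"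
    unfolding prod_sym_unit[OF finite_atLeastAtMost] times_divide_eq_right sum_divide_distrib[symmetric]
      sum_distrib_left sum.swap[of _ "Pow ?I" ?P] ..
  also have "\<dots> = T \<rho>1 \<rho>2 \<alpha> \<beta>"
    by (simp add: one card_Pow)
  finally show ?thesis .
qed

lemma is_ghost_vertex_unique:
  assumes "is_ghost_vertex \<kappa> \<zeta> n p T" "is_ghost_vertex \<kappa> \<zeta> n p T'"
  shows "T = T'"
proof (intro ext)
  fix \<rho>1 \<rho>2 :: 4 and \<alpha> \<beta> :: "nat \<Rightarrow> 4"
  let ?a = "\<lambda>i. sym_unit (\<alpha> i) (\<beta> i)"
  let ?c = "axis \<rho>1 1 :: complex ^ 4" and ?b = "axis \<rho>2 1 :: complex ^ 4"
  \<comment> \<open>Any position serves for the comparison, since \<open>Q\<close> is the same at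
    all of them.\<close>
  let ?F = "\<lambda>\<epsilon>. ghost_order (n - 2) \<kappa> \<zeta> (wave_tensor n \<epsilon> ?a p) (wave_covector ?c (p 1)) (wave_covector ?b (p 2)) 0"
  have ex: "\<exists>Q. has_multilinear_coeff ?F {3..n} Q \<and> contract n T ?c ?b ?a = \<i> * Q"
    if "is_ghost_vertex \<kappa> \<zeta> n p T" for T
  proof -
    have "\<forall>i\<in>{3..n}. transpose (?a i) = ?a i"
      by (simp add: transpose_sym_unit)
    from that[unfolded is_ghost_vertex_def, THEN conjunct2, THEN conjunct2, THEN spec, THEN spec, THEN spec,
        THEN mp, OF this]
    show ?thesis by blast
  qed
  obtain Q Q' where Q: "has_multilinear_coeff ?F {3..n} Q" "contract n T ?c ?b ?a = \<i> * Q"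
    and Q': "has_multilinear_coeff ?F {3..n} Q'" "contract n T' ?c ?b ?a = \<i> * Q'"
    using ex[OF assms(1)] ex[OF assms(2)] by blast
  have "contract n T ?c ?b ?a = contract n T' ?c ?b ?a"
    using has_multilinear_coeff_unique[OF Q(1) Q'(1)] Q(2) Q'(2) by simp
  then show "T \<rho>1 \<rho>2 \<alpha> \<beta> = T' \<rho>1 \<rho>2 \<alpha> \<beta>"
    using assms by (simp add: contract_sym_unit is_ghost_vertex_def)
qed

lemma ghost_vertex_eq: "is_ghost_vertex \<kappa> \<zeta> n p T \<Longrightarrow> ghost_vertex \<kappa> \<zeta> n p = T"
  unfolding ghost_vertex_def by (rule the_equality) (auto intro: is_ghost_vertex_unique)

text \<open>The average over all exchanges, a normalisation under which contractions with symmetric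
  matrices stay the same. It produces the factor \<open>1 / 2 ^ (n - 2)\<close> of the vertex
  rule.\<close>

definition symmetrise :: "nat \<Rightarrow> vertex_tensor \<Rightarrow> vertex_tensor" where
  "symmetrise n K \<rho>1 \<rho>2 \<mu> \<nu> = (\<Sum>S\<in>Pow {3..n}. K \<rho>1 \<rho>2 (swap_at S \<mu> \<nu>) (swap_at S \<nu> \<mu>)) / 2 ^ card {3..n}"

lemma symmetrise_vertex_tensor:
  assumes "is_vertex_tensor n K"
  shows "is_vertex_tensor n (symmetrise n K)"
  unfolding is_vertex_tensor_def symmetrise_def
proof (intro allI impI)
  fix \<rho>1 \<rho>2 and \<mu> \<nu> \<mu>' \<nu>' :: "nat \<Rightarrow> 4"
  assume eq: "\<forall>i\<in>{3..n}. \<mu> i = \<mu>' i \<and> \<nu> i = \<nu>' i"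
  have "K \<rho>1 \<rho>2 (swap_at S \<mu> \<nu>) (swap_at S \<nu> \<mu>) = K \<rho>1 \<rho>2 (swap_at S \<mu>' \<nu>') (swap_at S \<nu>' \<mu>')" for S
  proof -
    have "\<forall>i\<in>{3..n}. swap_at S \<mu> \<nu> i = swap_at S \<mu>' \<nu>' i \<and> swap_at S \<nu> \<mu> i = swap_at S \<nu>' \<mu>' i"
      using eq by (simp add: swap_at_def)
    then show ?thesis
      using assms unfolding is_vertex_tensor_def by blast
  qed
  then show "(\<Sum>S\<in>Pow {3..n}. K \<rho>1 \<rho>2 (swap_at S \<mu> \<nu>) (swap_at S \<nu> \<mu>)) / 2 ^ card {3..n} =
    (\<Sum>S\<in>Pow {3..n}. K \<rho>1 \<rho>2 (swap_at S \<mu>' \<nu>') (swap_at S \<nu>' \<mu>')) / 2 ^ card {3..n}"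
    by simp
qed

text \<open>Exchanging the pair \<open>i\<close> amounts to toggling the membership of
  \<open>i\<close> in \<open>S\<close>, an involution of the index set of the average.\<close>

lemma symmetrise_pair_symmetric: "pair_symmetric n (symmetrise n K)"
  unfolding pair_symmetric_def
proof (intro ballI allI)
  fix i \<rho>1 \<rho>2 and \<mu> \<nu> :: "nat \<Rightarrow> 4"
  assume i: "i \<in> {3..n}"
  let ?t = "\<lambda>S. if i \<in> S then S - {i} else insert i S"
  have "swap_at S (\<mu>(i := \<nu> i)) (\<nu>(i := \<mu> i)) = swap_at (?t S) \<mu> \<nu>"
    "swap_at S (\<nu>(i := \<mu> i)) (\<mu>(i := \<nu> i)) = swap_at (?t S) \<nu> \<mu>" for S
    by (auto simp: swap_at_def fun_eq_iff)
  then have "(\<Sum>S\<in>Pow {3..n}. K \<rho>1 \<rho>2 (swap_at S (\<mu>(i := \<nu> i)) (\<nu>(i := \<mu> i))) (swap_at S (\<nu>(i := \<mu> i)) (\<mu>(i := \<nu> i)))) =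
    (\<Sum>S\<in>Pow {3..n}. K \<rho>1 \<rho>2 (swap_at (?t S) \<mu> \<nu>) (swap_at (?t S) \<nu> \<mu>))"
    by simp
  also have "\<dots> = (\<Sum>S\<in>Pow {3..n}. K \<rho>1 \<rho>2 (swap_at S \<mu> \<nu>) (swap_at S \<nu> \<mu>))"
    by (rule sum.reindex_bij_witness[where i = ?t and j = ?t]) (use i in \<open>auto simp: insert_absorb\<close>)
  finally show "symmetrise n K \<rho>1 \<rho>2 (\<mu>(i := \<nu> i)) (\<nu>(i := \<mu> i)) = symmetrise n K \<rho>1 \<rho>2 \<mu> \<nu>"
    by (simp add: symmetrise_def)
qed

lemma swap_at_swap_at [simp]: "swap_at S (swap_at S \<mu> \<nu>) (swap_at S \<nu> \<mu>) = \<mu>"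
  by (auto simp: swap_at_def fun_eq_iff)

text \<open>Exchanging is an involution on pairs of index tuples, and symmetric matrices give the
  same product before and after it.\<close>

lemma contract_swap_at:
  assumes S: "S \<subseteq> {3..n}" and a: "\<And>i. i \<in> {3..n} \<Longrightarrow> transpose (a i) = a i"
  shows "contract n (\<lambda>\<rho>1 \<rho>2 \<mu> \<nu>. K \<rho>1 \<rho>2 (swap_at S \<mu> \<nu>) (swap_at S \<nu> \<mu>)) c b a = contract n K c b a"
proof -
  let ?P = "{3..n} \<rightarrow>\<^sub>E (UNIV :: 4 set)"
  let ?s = "\<lambda>(\<mu>, \<nu>). (swap_at S \<mu> \<nu>, swap_at S \<nu> \<mu>)"
  have P: "swap_at S \<mu> \<nu> \<in> ?P" if "\<mu> \<in> ?P" "\<nu> \<in> ?P" for \<mu> \<nu>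
    using that S by (auto simp: swap_at_def PiE_def extensional_def)
  have "(\<Sum>(\<mu>, \<nu>)\<in>?P \<times> ?P. K \<rho>1 \<rho>2 (swap_at S \<mu> \<nu>) (swap_at S \<nu> \<mu>) * c $ \<rho>1 * b $ \<rho>2 * (\<Prod>i=3..n. a i $ \<mu> i $ \<nu> i)) =
    (\<Sum>(\<mu>, \<nu>)\<in>?P \<times> ?P. K \<rho>1 \<rho>2 \<mu> \<nu> * c $ \<rho>1 * b $ \<rho>2 * (\<Prod>i=3..n. a i $ \<mu> i $ \<nu> i))" for \<rho>1 \<rho>2
  proof (rule sum.reindex_bij_witness[where i = ?s and j = ?s])
    fix x assume x: "x \<in> ?P \<times> ?P"
    obtain \<mu> \<nu> where x_eq: "x = (\<mu>, \<nu>)"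
      by (rule prod.exhaust)
    have *: "(\<Prod>i=3..n. a i $ swap_at S \<mu> \<nu> i $ swap_at S \<nu> \<mu> i) = (\<Prod>i=3..n. a i $ \<mu> i $ \<nu> i)"
    proof (intro prod.cong refl)
      fix i assume "i \<in> {3..n}"
      then have "transpose (a i) $ \<mu> i $ \<nu> i = a i $ \<mu> i $ \<nu> i"
        using a by simp
      then have "a i $ \<nu> i $ \<mu> i = a i $ \<mu> i $ \<nu> i"
        by (simp add: transpose_def)
      then show "a i $ swap_at S \<mu> \<nu> i $ swap_at S \<nu> \<mu> i = a i $ \<mu> i $ \<nu> i"
        by (simp add: swap_at_def)
    qed
    show "?s (?s x) = x" "?s (?s x) = x"
      by (simp_all add: x_eq)
    show "?s x \<in> ?P \<times> ?P" "?s x \<in> ?P \<times> ?P"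
      using x P by (simp_all add: x_eq)
    from * show "(case ?s x of (\<mu>, \<nu>) \<Rightarrow> K \<rho>1 \<rho>2 \<mu> \<nu> * c $ \<rho>1 * b $ \<rho>2 * (\<Prod>i=3..n. a i $ \<mu> i $ \<nu> i)) =
      (case x of (\<mu>, \<nu>) \<Rightarrow> K \<rho>1 \<rho>2 (swap_at S \<mu> \<nu>) (swap_at S \<nu> \<mu>) * c $ \<rho>1 * b $ \<rho>2 * (\<Prod>i=3..n. a i $ \<mu> i $ \<nu> i))"
      by (simp add: x_eq)
  qed
  then show ?thesis
    unfolding contract_def by (simp add: sum.cartesian_product)
qed

lemma contract_sum: "contract n (\<lambda>\<rho>1 \<rho>2 \<mu> \<nu>. \<Sum>j\<in>J. K j \<rho>1 \<rho>2 \<mu> \<nu>) c b a = (\<Sum>j\<in>J. contract n (K j) c b a)"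
  unfolding contract_def sum_distrib_right sum.swap[of _ J] ..

lemma contract_cmult: "contract n (\<lambda>\<rho>1 \<rho>2 \<mu> \<nu>. z * K \<rho>1 \<rho>2 \<mu> \<nu>) c b a = z * contract n K c b a"
  unfolding contract_def by (simp add: sum_distrib_left mult.assoc)

lemma contract_symmetrise:
  assumes "\<And>i. i \<in> {3..n} \<Longrightarrow> transpose (a i) = a i"
  shows "contract n (symmetrise n K) c b a = contract n K c b a"
proof -
  have "symmetrise n K = (\<lambda>\<rho>1 \<rho>2 \<mu> \<nu>. (1 / 2 ^ card {3..n}) *
    (\<Sum>S\<in>Pow {3..n}. K \<rho>1 \<rho>2 (swap_at S \<mu> \<nu>) (swap_at S \<nu> \<mu>)))"
    by (simp add: symmetrise_def fun_eq_iff)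
  then have "contract n (symmetrise n K) c b a = (1 / 2 ^ card {3..n}) *
    (\<Sum>S\<in>Pow {3..n}. contract n (\<lambda>\<rho>1 \<rho>2 \<mu> \<nu>. K \<rho>1 \<rho>2 (swap_at S \<mu> \<nu>) (swap_at S \<nu> \<mu>)) c b a)"
    by (simp only: contract_cmult contract_sum)
  also have "(\<Sum>S\<in>Pow {3..n}. contract n (\<lambda>\<rho>1 \<rho>2 \<mu> \<nu>. K \<rho>1 \<rho>2 (swap_at S \<mu> \<nu>) (swap_at S \<nu> \<mu>)) c b a) =
    (\<Sum>S\<in>Pow {3..n}. contract n K c b a)"
    by (intro sum.cong refl contract_swap_at assms) auto
  finally show ?thesis
    by (simp add: card_Pow)
qed

text \<open>Moves a permutation from the tensor indices to the amplitudes by renaming the summation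
  indices.\<close>

lemma contract_permute:
  assumes s: "s permutes {3..n}"
  shows "contract n (\<lambda>\<rho>1 \<rho>2 \<mu> \<nu>. K \<rho>1 \<rho>2 (\<mu> \<circ> s) (\<nu> \<circ> s)) c b a = contract n K c b (a \<circ> s)"
proof -
  let ?P = "{3..n} \<rightarrow>\<^sub>E (UNIV :: 4 set)"
  have P: "\<mu> \<circ> t \<in> ?P" if "\<mu> \<in> ?P" "t permutes {3..n}" for \<mu> t
    using that by (auto simp: PiE_def extensional_def permutes_not_in)
  have re: "(\<Sum>\<mu>\<in>?P. g (\<mu> \<circ> s)) = (\<Sum>\<mu>\<in>?P. g \<mu>)" for g :: "(nat \<Rightarrow> 4) \<Rightarrow> complex"
    by (rule sum.reindex_bij_witness[where i = "\<lambda>\<mu>. \<mu> \<circ> inv s" and j = "\<lambda>\<mu>. \<mu> \<circ> s"])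
       (use P s permutes_inv[OF s] in \<open>auto simp: o_assoc[symmetric] permutes_inv_o[OF s]\<close>)
  have "(\<Prod>i=3..n. a i $ \<mu> i $ \<nu> i) = (\<Prod>i=3..n. (a \<circ> s) i $ (\<mu> \<circ> s) i $ (\<nu> \<circ> s) i)" for \<mu> \<nu>
    using prod.permute[OF s, of "\<lambda>i. a i $ \<mu> i $ \<nu> i"] by (simp add: o_def)
  then have "contract n (\<lambda>\<rho>1 \<rho>2 \<mu> \<nu>. K \<rho>1 \<rho>2 (\<mu> \<circ> s) (\<nu> \<circ> s)) c b a =
    (\<Sum>\<rho>1\<in>UNIV. \<Sum>\<rho>2\<in>UNIV. \<Sum>\<mu>\<in>?P. \<Sum>\<nu>\<in>?P. K \<rho>1 \<rho>2 (\<mu> \<circ> s) (\<nu> \<circ> s) * c $ \<rho>1 * b $ \<rho>2 *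
      (\<Prod>i=3..n. (a \<circ> s) i $ (\<mu> \<circ> s) i $ (\<nu> \<circ> s) i))"
    unfolding contract_def by simp
  also have "\<dots> = (\<Sum>\<rho>1\<in>UNIV. \<Sum>\<rho>2\<in>UNIV. \<Sum>\<mu>\<in>?P. \<Sum>\<nu>\<in>?P. K \<rho>1 \<rho>2 (\<mu> \<circ> s) \<nu> * c $ \<rho>1 * b $ \<rho>2 *
      (\<Prod>i=3..n. (a \<circ> s) i $ (\<mu> \<circ> s) i $ \<nu> i))"
    by (intro sum.cong refl re)
  also have "\<dots> = contract n K c b (a \<circ> s)"
    unfolding contract_def by (intro sum.cong refl re)
  finally show ?thesis .
qed

section \<open>The density on plane waves\<close>

lemma wave_tensor_differentiable: "(\<lambda>y. wave_tensor n \<epsilon> a p y $ \<mu> $ \<nu>) differentiable (at x)"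
  unfolding wave_tensor_def vec_lambda_beta
  by (intro differentiable_sum ballI differentiable_mult) simp_all

lemma partial_wave_tensor:
  "partial \<rho> (\<lambda>y. wave_tensor n \<epsilon> a p y $ \<mu> $ \<nu>) x =
    (\<Sum>i=3..n. \<epsilon> i * wave (p i) x * (\<i> * complex_of_real (lower (p i) \<rho>) * a i $ \<mu> $ \<nu>))"
  unfolding wave_tensor_def vec_lambda_beta
  by (subst partial_sum) (simp_all add: partial_cmult partial_wave, simp add: mult_ac)

text \<open>The Christoffel symbol of the single plane wave \<open>A * wave q\<close>, without the exponential.\<close>

definition wave_Gamma :: "complex ^ 4 ^ 4 \<Rightarrow> real ^ 4 \<Rightarrow> 4 \<Rightarrow> 4 \<Rightarrow> 4 \<Rightarrow> complex" where
  "wave_Gamma A q \<rho> \<sigma> l = \<i> / 2 *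
     (complex_of_real (lower q \<rho>) * A $ \<sigma> $ l + complex_of_real (lower q \<sigma>) * A $ l $ \<rho>
      - complex_of_real (lower q l) * A $ \<rho> $ \<sigma>)"

lemma Gamma_lin_wave_tensor:
  "Gamma_lin (wave_tensor n \<epsilon> a p) \<rho> \<sigma> l x =
    (\<Sum>i=3..n. \<epsilon> i * wave (p i) x * wave_Gamma (a i) (p i) \<rho> \<sigma> l)"
  by (simp add: Gamma_lin_def partial_wave_tensor wave_Gamma_def sum_divide_distrib sum.distrib[symmetric]
      sum_subtractf[symmetric] algebra_simps add_divide_distrib diff_divide_distrib)

lemma diff_fields_wave: "diff_fields (wave_tensor n \<epsilon> a p) (wave_covector c q)"
proof -
  have "Gamma_lin (wave_tensor n \<epsilon> a p) \<mu> \<nu> \<rho> differentiable (at x)" for \<mu> \<nu> \<rho> x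
    unfolding Gamma_lin_wave_tensor[abs_def]
    by (intro differentiable_sum ballI differentiable_mult) simp_all
  then show ?thesis
    by (auto simp: diff_fields_def diff_tensor_def wave_tensor_differentiable wave_covector_def intro!: differentiable_mult)
qed

section \<open>Expansion of products of plane wave sums over selections of gravitons\<close>

lemma sum_PiE_insert:
  assumes "x \<notin> I"
  shows "(\<Sum>f\<in>insert x I \<rightarrow>\<^sub>E A. F f) = (\<Sum>y\<in>A. \<Sum>f\<in>I \<rightarrow>\<^sub>E A. F (f(x := y)))"
proof -
  have "(\<Sum>f\<in>insert x I \<rightarrow>\<^sub>E A. F f) = (\<Sum>(y, f)\<in>A \<times> (I \<rightarrow>\<^sub>E A). F (f(x := y)))"
    unfolding PiE_insert_eq
    by (subst sum.reindex) (use inj_combinator[OF assms, of "\<lambda>_. A"] in \<open>simp_all add: split_def\<close>)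
  then show ?thesis
    by (simp add: sum.cartesian_product)
qed

lemma chain_cong: "(\<And>i. 4 \<le> i \<Longrightarrow> i < j + 4 \<Longrightarrow> A i = B i) \<Longrightarrow> chain A j = chain B j"
  by (induction j) simp_all

text \<open>The noncommutative multinomial expansion: \<open>f\<close> says which summand is taken
  at which position. The order of the matrices matters, so selections cannot be collected by
  multiplicity.\<close>

lemma chain_sum:
  fixes z :: "nat \<Rightarrow> complex" and h :: "complex ^ 4 ^ 4"
  assumes h: "\<And>\<mu> \<nu>. h $ \<mu> $ \<nu> = (\<Sum>i\<in>J. z i * a i $ \<mu> $ \<nu>)"
  shows "chain (\<lambda>_. h) j $ \<mu> $ \<nu> =
    (\<Sum>f\<in>{4..<j + 4} \<rightarrow>\<^sub>E J. (\<Prod>i\<in>{4..<j + 4}. z (f i)) * chain (a \<circ> f) j $ \<mu> $ \<nu>)"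
proof (induction j arbitrary: \<mu> \<nu>)
  case 0
  show ?case by simp
next
  case (Suc j)
  let ?I = "{4..<j + 4}"
  have I: "{4..<Suc j + 4} = insert (j + 4) ?I" "j + 4 \<notin> ?I"
    by auto
  have "chain (\<lambda>_. h) (Suc j) $ \<mu> $ \<nu> =
    (\<Sum>\<beta>\<in>UNIV. \<Sum>\<alpha>\<in>UNIV. (\<Sum>f\<in>?I \<rightarrow>\<^sub>E J. (\<Prod>i\<in>?I. z (f i)) * chain (a \<circ> f) j $ \<mu> $ \<alpha>) *
      (\<Sum>y\<in>J. z y * a y $ \<alpha> $ \<beta>) * etaM $ \<beta> $ \<nu>)"
    by (simp add: matrix_matrix_mult_def Suc h sum_distrib_right o_def)
  also have "\<dots> = (\<Sum>\<beta>\<in>UNIV. \<Sum>\<alpha>\<in>UNIV. \<Sum>y\<in>J. \<Sum>f\<in>?I \<rightarrow>\<^sub>E J. z y * (\<Prod>i\<in>?I. z (f i)) *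
      (chain (a \<circ> f) j $ \<mu> $ \<alpha> * a y $ \<alpha> $ \<beta> * etaM $ \<beta> $ \<nu>))"
    unfolding sum_product
    unfolding sum_distrib_right sum.swap[of _ J "?I \<rightarrow>\<^sub>E J"]
    by (intro sum.cong refl) (simp only: mult_ac)
  also have "\<dots> = (\<Sum>y\<in>J. \<Sum>f\<in>?I \<rightarrow>\<^sub>E J. z y * (\<Prod>i\<in>?I. z (f i)) *
      (\<Sum>\<beta>\<in>UNIV. \<Sum>\<alpha>\<in>UNIV. chain (a \<circ> f) j $ \<mu> $ \<alpha> * a y $ \<alpha> $ \<beta> * etaM $ \<beta> $ \<nu>))"
    unfolding sum_distrib_left sum.swap[of _ J UNIV] sum.swap[of _ "?I \<rightarrow>\<^sub>E J" UNIV] ..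
  also have "\<dots> = (\<Sum>y\<in>J. \<Sum>f\<in>?I \<rightarrow>\<^sub>E J. z y * (\<Prod>i\<in>?I. z (f i)) * chain (a \<circ> f(j + 4 := y)) (Suc j) $ \<mu> $ \<nu>)"
  proof (intro sum.cong refl)
    fix y f
    have "chain (a \<circ> f(j + 4 := y)) j = chain (a \<circ> f) j"
      by (rule chain_cong) simp
    then show "z y * (\<Prod>i\<in>?I. z (f i)) *
        (\<Sum>\<beta>\<in>UNIV. \<Sum>\<alpha>\<in>UNIV. chain (a \<circ> f) j $ \<mu> $ \<alpha> * a y $ \<alpha> $ \<beta> * etaM $ \<beta> $ \<nu>) =
      z y * (\<Prod>i\<in>?I. z (f i)) * chain (a \<circ> f(j + 4 := y)) (Suc j) $ \<mu> $ \<nu>"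
      by (simp add: matrix_matrix_mult_def sum_distrib_right)
  qed
  also have "\<dots> = (\<Sum>y\<in>J. \<Sum>f\<in>?I \<rightarrow>\<^sub>E J. (\<Prod>i\<in>{4..<Suc j + 4}. z ((f(j + 4 := y)) i)) *
      chain (a \<circ> f(j + 4 := y)) (Suc j) $ \<mu> $ \<nu>)"
  proof (intro sum.cong refl arg_cong2[where f = "(*)"])
    fix y f
    have "(\<Prod>i\<in>?I. z ((f(j + 4 := y)) i)) = (\<Prod>i\<in>?I. z (f i))"
      by (intro prod.cong) auto
    then show "z y * (\<Prod>i\<in>?I. z (f i)) = (\<Prod>i\<in>{4..<Suc j + 4}. z ((f(j + 4 := y)) i))"
      unfolding I(1) by (subst prod.insert) auto
  qed
  also have "\<dots> = (\<Sum>f\<in>{4..<Suc j + 4} \<rightarrow>\<^sub>E J. (\<Prod>i\<in>{4..<Suc j + 4}. z (f i)) * chain (a \<circ> f) (Suc j) $ \<mu> $ \<nu>)"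
    unfolding I(1) sum_PiE_insert[OF I(2)] ..
  finally show ?case .
qed

definition chain_Gamma ::
  "nat \<Rightarrow> complex ^ 4 \<Rightarrow> (nat \<Rightarrow> complex ^ 4 ^ 4) \<Rightarrow> (nat \<Rightarrow> real ^ 4) \<Rightarrow> 4 \<Rightarrow> 4 \<Rightarrow> complex" where
  "chain_Gamma j c a p \<rho> \<sigma> = (\<Sum>\<nu>\<in>UNIV. \<Sum>l\<in>UNIV. chain a j $ \<nu> $ l * wave_Gamma (a 3) (p 3) \<rho> \<sigma> l * c $ \<nu>)"

text \<open>All selections \<open>f\<close> are kept, including those that repeat a graviton,
  because the multilinear coefficient is defined through a polynomial identity valid for all values
  of \<open>\<epsilon>\<close>.\<close>

lemma chain_current_wave:
  assumes n: "n = j + 3"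
  shows "chain_current j (wave_tensor n \<epsilon> a p) (ghost_source (wave_tensor n \<epsilon> a p) (wave_covector c q) \<rho> \<sigma>) y =
    (\<Sum>f\<in>{3..n} \<rightarrow>\<^sub>E {3..n}. (\<Prod>i=3..n. \<epsilon> (f i)) * chain_Gamma j c (a \<circ> f) (p \<circ> f) \<rho> \<sigma> *
      wave (q + (\<Sum>i=3..n. p (f i))) y)"
proof -
  let ?J = "{3..n}" and ?I = "{4..<j + 4}"
  let ?z = "\<lambda>i. \<epsilon> i * wave (p i) y"
  have J: "?J = insert 3 ?I" "3 \<notin> ?I"
    using n by auto
  have "chain_current j (wave_tensor n \<epsilon> a p) (ghost_source (wave_tensor n \<epsilon> a p) (wave_covector c q) \<rho> \<sigma>) y =
    (\<Sum>\<nu>\<in>UNIV. \<Sum>l\<in>UNIV. (\<Sum>f\<in>?I \<rightarrow>\<^sub>E ?J. (\<Prod>i\<in>?I. ?z (f i)) * chain (a \<circ> f) j $ \<nu> $ l) *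
      ((\<Sum>i\<in>?J. ?z i * wave_Gamma (a i) (p i) \<rho> \<sigma> l) * (c $ \<nu> * wave q y)))"
    unfolding chain_current_def ghost_source_def Gamma_lin_wave_tensor
    by (subst chain_sum[where J = ?J and z = ?z and a = a])
       (simp_all add: wave_tensor_def wave_covector_def mult_ac)
  also have "\<dots> = (\<Sum>\<nu>\<in>UNIV. \<Sum>l\<in>UNIV. \<Sum>i\<in>?J. \<Sum>f\<in>?I \<rightarrow>\<^sub>E ?J. ?z i * (\<Prod>i\<in>?I. ?z (f i)) * wave q y *
      (chain (a \<circ> f) j $ \<nu> $ l * wave_Gamma (a i) (p i) \<rho> \<sigma> l * c $ \<nu>))"
    unfolding sum_distrib_right sum_distrib_left sum.swap[of _ ?J "?I \<rightarrow>\<^sub>E ?J"]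
    by (intro sum.cong refl) (simp only: mult_ac)
  also have "\<dots> = (\<Sum>i\<in>?J. \<Sum>f\<in>?I \<rightarrow>\<^sub>E ?J. ?z i * (\<Prod>i\<in>?I. ?z (f i)) * wave q y *
      (\<Sum>\<nu>\<in>UNIV. \<Sum>l\<in>UNIV. chain (a \<circ> f) j $ \<nu> $ l * wave_Gamma (a i) (p i) \<rho> \<sigma> l * c $ \<nu>))"
    unfolding sum_distrib_left sum.swap[of _ ?J UNIV] sum.swap[of _ "?I \<rightarrow>\<^sub>E ?J" UNIV] ..
  also have "\<dots> = (\<Sum>k\<in>?J. \<Sum>f\<in>?I \<rightarrow>\<^sub>E ?J. (\<Prod>i\<in>?J. ?z ((f(3 := k)) i)) * wave q y *
      chain_Gamma j c (a \<circ> f(3 := k)) (p \<circ> f(3 := k)) \<rho> \<sigma>)"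
  proof (intro sum.cong refl arg_cong2[where f = "(*)"])
    fix k f
    have "(\<Prod>i\<in>?I. ?z ((f(3 := k)) i)) = (\<Prod>i\<in>?I. ?z (f i))"
      by (intro prod.cong) auto
    then show "?z k * (\<Prod>i\<in>?I. ?z (f i)) = (\<Prod>i\<in>?J. ?z ((f(3 := k)) i))"
      unfolding J(1) by (subst prod.insert) auto
    have "chain (a \<circ> f(3 := k)) j = chain (a \<circ> f) j"
      by (rule chain_cong) simp
    then show "(\<Sum>\<nu>\<in>UNIV. \<Sum>l\<in>UNIV. chain (a \<circ> f) j $ \<nu> $ l * wave_Gamma (a k) (p k) \<rho> \<sigma> l * c $ \<nu>) =
      chain_Gamma j c (a \<circ> f(3 := k)) (p \<circ> f(3 := k)) \<rho> \<sigma>"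
      by (simp add: chain_Gamma_def)
  qed
  also have "\<dots> = (\<Sum>f\<in>?J \<rightarrow>\<^sub>E ?J. (\<Prod>i\<in>?J. ?z (f i)) * wave q y * chain_Gamma j c (a \<circ> f) (p \<circ> f) \<rho> \<sigma>)"
    using sum_PiE_insert[OF J(2), of "\<lambda>f. (\<Prod>i\<in>?J. ?z (f i)) * wave q y * chain_Gamma j c (a \<circ> f) (p \<circ> f) \<rho> \<sigma>" ?J]
    unfolding J(1)[symmetric] by simp
  also have "\<dots> = (\<Sum>f\<in>?J \<rightarrow>\<^sub>E ?J. (\<Prod>i\<in>?J. \<epsilon> (f i)) * chain_Gamma j c (a \<circ> f) (p \<circ> f) \<rho> \<sigma> *
      wave (q + (\<Sum>i\<in>?J. p (f i))) y)"
    by (simp add: wave_add wave_sum prod.distrib mult_ac)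
  finally show ?thesis .
qed

lemma raise_wave_covector: "raise (wave_covector b q x) \<mu> = raise b \<mu> * wave q x"
  by (simp add: raise_def wave_covector_def sum_distrib_left mult_ac)

text \<open>\<open>P\<close> is the total momentum of the differentiated product. It is a separate
  argument because for a selection with repetitions it is not fixed by momentum
  conservation.\<close>

definition wave_amplitude ::
  "nat \<Rightarrow> complex ^ 4 \<Rightarrow> complex ^ 4 \<Rightarrow> (nat \<Rightarrow> complex ^ 4 ^ 4) \<Rightarrow> (nat \<Rightarrow> real ^ 4) \<Rightarrow> real ^ 4 \<Rightarrow> complex" where
  "wave_amplitude j c b a p P = - 1 / 2 * (- 1) ^ j *
     (\<Sum>\<rho>\<in>UNIV. \<Sum>\<sigma>\<in>UNIV. \<Sum>\<mu>\<in>UNIV. complex_of_real (eta \<rho> \<sigma>) * raise b \<mu> *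
       (\<i> * complex_of_real (lower P \<mu>) * chain_Gamma j c a p \<rho> \<sigma>
        - 2 * (\<i> * complex_of_real (lower P \<rho>) * chain_Gamma j c a p \<mu> \<sigma>)))"

text \<open>The antighost stands outside the derivatives: its momentum \<open>q'\<close> enters the
  exponential but not the amplitude.\<close>

lemma ghost_order_wave:
  assumes n: "n = j + 3"
  shows "ghost_order (Suc j) \<kappa> \<zeta> (wave_tensor n \<epsilon> a p) (wave_covector c q) (wave_covector b q') x =
    (\<Sum>f\<in>{3..n} \<rightarrow>\<^sub>E {3..n}. complex_of_real \<kappa> ^ Suc j *
      (wave_amplitude j c b (a \<circ> f) (p \<circ> f) (q + (\<Sum>i=3..n. p (f i))) *
       wave (q + (\<Sum>i=3..n. p (f i)) + q') x) * (\<Prod>i=3..n. \<epsilon> (f i)))"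
proof -
  let ?F = "{3..n} \<rightarrow>\<^sub>E {3..n}"
  let ?P = "\<lambda>f. q + (\<Sum>i=3..n. p (f i))"
  let ?h = "wave_tensor n \<epsilon> a p"
  have p: "partial \<mu> (chain_current j ?h (ghost_source ?h (wave_covector c q) \<rho> \<sigma>)) x =
    (\<Sum>f\<in>?F. (\<Prod>i=3..n. \<epsilon> (f i)) * chain_Gamma j c (a \<circ> f) (p \<circ> f) \<rho> \<sigma> *
      (\<i> * complex_of_real (lower (?P f) \<mu>) * wave (?P f) x))" for \<mu> \<rho> \<sigma>
    unfolding chain_current_wave[OF n, abs_def]
    by (subst partial_sum) (simp_all add: partial_cmult partial_wave)
  have "(\<Sum>\<rho>\<in>UNIV. \<Sum>\<sigma>\<in>UNIV. \<Sum>\<mu>\<in>UNIV. complex_of_real (eta \<rho> \<sigma>) * raise (wave_covector b q' x) \<mu> *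
      (partial \<mu> (chain_current j ?h (ghost_source ?h (wave_covector c q) \<rho> \<sigma>)) x
       - 2 * partial \<rho> (chain_current j ?h (ghost_source ?h (wave_covector c q) \<mu> \<sigma>)) x)) =
    (\<Sum>\<rho>\<in>UNIV. \<Sum>\<sigma>\<in>UNIV. \<Sum>\<mu>\<in>UNIV. \<Sum>f\<in>?F. (\<Prod>i=3..n. \<epsilon> (f i)) * wave (?P f + q') x *
      (complex_of_real (eta \<rho> \<sigma>) * raise b \<mu> *
       (\<i> * complex_of_real (lower (?P f) \<mu>) * chain_Gamma j c (a \<circ> f) (p \<circ> f) \<rho> \<sigma>
        - 2 * (\<i> * complex_of_real (lower (?P f) \<rho>) * chain_Gamma j c (a \<circ> f) (p \<circ> f) \<mu> \<sigma>))))"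
    unfolding p raise_wave_covector wave_add[of _ q'] sum_distrib_left sum_subtractf[symmetric]
    by (intro sum.cong refl) (simp add: algebra_simps)
  also have "\<dots> = (\<Sum>f\<in>?F. (\<Prod>i=3..n. \<epsilon> (f i)) * wave (?P f + q') x *
    (\<Sum>\<rho>\<in>UNIV. \<Sum>\<sigma>\<in>UNIV. \<Sum>\<mu>\<in>UNIV. complex_of_real (eta \<rho> \<sigma>) * raise b \<mu> *
       (\<i> * complex_of_real (lower (?P f) \<mu>) * chain_Gamma j c (a \<circ> f) (p \<circ> f) \<rho> \<sigma>
        - 2 * (\<i> * complex_of_real (lower (?P f) \<rho>) * chain_Gamma j c (a \<circ> f) (p \<circ> f) \<mu> \<sigma>))))"
    unfolding sum_distrib_left sum.swap[of _ ?F UNIV] ..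
  finally show ?thesis
    unfolding ghost_order_def ghost_lagrangian_fps[OF diff_fields_wave]
    by (simp only: sum_distrib_left wave_amplitude_def mult_ac)
qed

lemma wave_amplitude_cong:
  assumes "\<And>i. i \<in> {3..j + 3} \<Longrightarrow> a i = a' i" "\<And>i. i \<in> {3..j + 3} \<Longrightarrow> p i = p' i"
  shows "wave_amplitude j c b a p P = wave_amplitude j c b a' p' P"
proof -
  have "chain a j = chain a' j" "a 3 = a' 3" "p 3 = p' 3"
    by (auto intro!: chain_cong assms)
  then show ?thesis
    by (simp add: wave_amplitude_def chain_Gamma_def)
qed

text \<open>A permutation preserves the total graviton momentum, so conservation also makes the
  overall exponential equal to 1; this is why the coefficient is independent of \<open>x\<close>.
  Selections with repetitions may keep their exponential, but they feed other monomials.\<close>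

lemma has_multilinear_coeff_wave:
  assumes n: "n = j + 3" and mom: "(\<Sum>i=1..n. p i) = 0"
  shows "has_multilinear_coeff
    (\<lambda>\<epsilon>. ghost_order (Suc j) \<kappa> \<zeta> (wave_tensor n \<epsilon> a p) (wave_covector c (p 1)) (wave_covector b (p 2)) x) {3..n}
    (\<Sum>s | s permutes {3..n}. complex_of_real \<kappa> ^ Suc j * wave_amplitude j c b (a \<circ> s) (p \<circ> s) (- p 2))"
proof -
  let ?P = "\<lambda>f. p 1 + (\<Sum>i=3..n. p (f i))"
  define K where "K = (\<lambda>f. complex_of_real \<kappa> ^ Suc j *
    (wave_amplitude j c b (a \<circ> f) (p \<circ> f) (?P f) * wave (?P f + p 2) x))"
  have "has_multilinear_coeff
    (\<lambda>\<epsilon>. ghost_order (Suc j) \<kappa> \<zeta> (wave_tensor n \<epsilon> a p) (wave_covector c (p 1)) (wave_covector b (p 2)) x) {3..n}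
    (\<Sum>f\<in>{f \<in> {3..n} \<rightarrow>\<^sub>E {3..n}. bij_betw f {3..n} {3..n}}. K f)"
    by (rule has_multilinear_coeff_PiE) (simp_all only: finite_atLeastAtMost ghost_order_wave[OF n] K_def)
  also have "(\<Sum>f\<in>{f \<in> {3..n} \<rightarrow>\<^sub>E {3..n}. bij_betw f {3..n} {3..n}}. K f) = (\<Sum>s | s permutes {3..n}. K s)"
  proof (rule sum_bij_PiE_permutes)
    fix f g :: "nat \<Rightarrow> nat" assume fg: "\<And>i. i \<in> {3..n} \<Longrightarrow> f i = g i"
    then have "?P f = ?P g"
      by simp
    moreover have "wave_amplitude j c b (a \<circ> f) (p \<circ> f) (?P g) = wave_amplitude j c b (a \<circ> g) (p \<circ> g) (?P g)"
      by (rule wave_amplitude_cong) (use fg n in auto)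
    ultimately show "K f = K g"
      by (simp add: K_def)
  qed
  also have "\<dots> = (\<Sum>s | s permutes {3..n}. complex_of_real \<kappa> ^ Suc j * wave_amplitude j c b (a \<circ> s) (p \<circ> s) (- p 2))"
  proof (intro sum.cong refl)
    fix s assume "s \<in> {s. s permutes {3..n}}"
    then have "(\<Sum>i=3..n. p (s i)) = (\<Sum>i=3..n. p i)"
      by (intro sum.reindex_bij_betw) (simp add: permutes_imp_bij)
    moreover have "{1..n} = insert 1 (insert 2 {3..n})"
      using n by auto
    then have "p 1 + p 2 + (\<Sum>i=3..n. p i) = 0"
      using mom by (simp add: add.assoc)
    ultimately have "?P s = - p 2"
      by (simp add: eq_neg_iff_add_eq_0 algebra_simps)
    then show "K s = complex_of_real \<kappa> ^ Suc j * wave_amplitude j c b (a \<circ> s) (p \<circ> s) (- p 2)"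
      by (simp add: K_def)
  qed
  finally show ?thesis .
qed

section \<open>Contraction of the explicit vertex\<close>

text \<open>Replaces the case distinction in \<open>N_factor\<close> by a recursion of the same
  shape as that of \<open>chain\<close>.\<close>

lemma N_factor_Suc:
  assumes "n \<ge> 3"
  shows "N_factor (Suc n) \<rho>1 l \<mu> \<nu> = N_factor n \<rho>1 (\<nu> (Suc n)) \<mu> \<nu> * eta (\<mu> (Suc n)) l"
proof (cases "n = 3")
  case True
  then show ?thesis by (simp add: N_factor_def numeral_eq_Suc)
next
  case False
  then show ?thesis using assms by (simp add: N_factor_def)
qed

lemma N_factor_cong:
  "(\<And>i. i \<in> {3..n} \<Longrightarrow> \<mu> i = \<mu>' i) \<Longrightarrow> (\<And>i. i \<in> {3..n} \<Longrightarrow> \<nu> i = \<nu>' i) \<Longrightarrow> n \<ge> 3 \<Longrightarrow>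
    N_factor n \<rho>1 l \<mu> \<nu> = N_factor n \<rho>1 l \<mu>' \<nu>'"
  by (auto simp: N_factor_def intro!: prod.cong arg_cong2[where f = "(*)"])

text \<open>Induction from the Christoffel end of the chain. The earlier part ends at the index
  \<nu> of the last graviton, so \<open>l\<close> must be arbitrary in the induction.
  \<open>N_factor\<close> meets that graviton with \<nu> first and \<mu> second, whereas its matrix
  has \<mu> first; symmetry of the matrix reconciles the two. The indices of particle 3 do not enter
  \<open>N_factor\<close> and are left to \<open>g\<close>.\<close>

lemma N_factor_contract:
  assumes "\<And>i. i \<in> {3..j + 3} \<Longrightarrow> transpose (a i) = a i"
  shows "(\<Sum>\<mu>\<in>{3..j + 3} \<rightarrow>\<^sub>E UNIV. \<Sum>\<nu>\<in>{3..j + 3} \<rightarrow>\<^sub>E UNIV.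
      complex_of_real (N_factor (j + 3) \<rho>1 l \<mu> \<nu>) * g (\<mu> 3) (\<nu> 3) * (\<Prod>i=3..j + 3. a i $ \<mu> i $ \<nu> i)) =
    chain a j $ \<rho>1 $ l * (\<Sum>\<alpha>\<in>UNIV. \<Sum>\<beta>\<in>UNIV. g \<alpha> \<beta> * a 3 $ \<alpha> $ \<beta>)"
  using assms
proof (induction j arbitrary: l)
  case 0
  have "{3..0 + 3} = insert 3 ({} :: nat set)"
    by auto
  then show ?case
    by (simp add: sum_PiE_insert N_factor_def sum_distrib_left mult.assoc)
next
  case (Suc j)
  let ?n = "j + 3" and ?G = "\<Sum>\<alpha>\<in>UNIV. \<Sum>\<beta>\<in>UNIV. g \<alpha> \<beta> * a 3 $ \<alpha> $ \<beta>"
  let ?P = "{3..?n} \<rightarrow>\<^sub>E (UNIV :: 4 set)"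
  have I: "{3..Suc j + 3} = insert (Suc ?n) {3..?n}" "Suc ?n \<notin> {3..?n}"
    by auto
  let ?t = "\<lambda>\<mu> \<nu>. complex_of_real (N_factor (Suc ?n) \<rho>1 l \<mu> \<nu>) * g (\<mu> 3) (\<nu> 3) *
    (\<Prod>i\<in>insert (Suc ?n) {3..?n}. a i $ \<mu> i $ \<nu> i)"
  have "(\<Sum>\<mu>\<in>{3..Suc j + 3} \<rightarrow>\<^sub>E UNIV. \<Sum>\<nu>\<in>{3..Suc j + 3} \<rightarrow>\<^sub>E UNIV.
      complex_of_real (N_factor (Suc j + 3) \<rho>1 l \<mu> \<nu>) * g (\<mu> 3) (\<nu> 3) * (\<Prod>i=3..Suc j + 3. a i $ \<mu> i $ \<nu> i)) =
    (\<Sum>x\<in>UNIV. \<Sum>\<mu>\<in>?P. \<Sum>y\<in>UNIV. \<Sum>\<nu>\<in>?P. ?t (\<mu>(Suc ?n := x)) (\<nu>(Suc ?n := y)))"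
    unfolding I(1) sum_PiE_insert[OF I(2)] by simp
  also have "\<dots> = (\<Sum>x\<in>UNIV. \<Sum>\<mu>\<in>?P. \<Sum>y\<in>UNIV. \<Sum>\<nu>\<in>?P. complex_of_real (eta x l) * a (Suc ?n) $ x $ y *
      (complex_of_real (N_factor ?n \<rho>1 y \<mu> \<nu>) * g (\<mu> 3) (\<nu> 3) * (\<Prod>i=3..?n. a i $ \<mu> i $ \<nu> i)))"
  proof (intro sum.cong refl)
    fix x y and \<mu> \<nu> :: "nat \<Rightarrow> 4"
    have "N_factor ?n \<rho>1 y (\<mu>(Suc ?n := x)) (\<nu>(Suc ?n := y)) = N_factor ?n \<rho>1 y \<mu> \<nu>"
      by (rule N_factor_cong) auto
    then have "N_factor (Suc ?n) \<rho>1 l (\<mu>(Suc ?n := x)) (\<nu>(Suc ?n := y)) = N_factor ?n \<rho>1 y \<mu> \<nu> * eta x l"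
      by (subst N_factor_Suc) simp_all
    moreover have "(\<Prod>i=3..?n. a i $ (\<mu>(Suc ?n := x)) i $ (\<nu>(Suc ?n := y)) i) = (\<Prod>i=3..?n. a i $ \<mu> i $ \<nu> i)"
      by (intro prod.cong) auto
    ultimately show "?t (\<mu>(Suc ?n := x)) (\<nu>(Suc ?n := y)) = complex_of_real (eta x l) * a (Suc ?n) $ x $ y *
      (complex_of_real (N_factor ?n \<rho>1 y \<mu> \<nu>) * g (\<mu> 3) (\<nu> 3) * (\<Prod>i=3..?n. a i $ \<mu> i $ \<nu> i))"
      by (subst prod.insert) simp_all
  qed
  also have "\<dots> = (\<Sum>x\<in>UNIV. \<Sum>y\<in>UNIV. complex_of_real (eta x l) * a (Suc ?n) $ x $ y *
      (\<Sum>\<mu>\<in>?P. \<Sum>\<nu>\<in>?P. complex_of_real (N_factor ?n \<rho>1 y \<mu> \<nu>) * g (\<mu> 3) (\<nu> 3) * (\<Prod>i=3..?n. a i $ \<mu> i $ \<nu> i)))"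
    unfolding sum_distrib_left sum.swap[of _ UNIV ?P] ..
  also have "\<dots> = (\<Sum>x\<in>UNIV. \<Sum>y\<in>UNIV. chain a j $ \<rho>1 $ y * a (Suc ?n) $ y $ x * complex_of_real (eta x l) * ?G)"
  proof (intro sum.cong refl)
    fix x y
    have "transpose (a (Suc ?n)) $ x $ y = a (Suc ?n) $ x $ y"
      using Suc.prems[of "Suc ?n"] by simp
    then have "a (Suc ?n) $ y $ x = a (Suc ?n) $ x $ y"
      by (simp add: transpose_def)
    then show "complex_of_real (eta x l) * a (Suc ?n) $ x $ y *
      (\<Sum>\<mu>\<in>?P. \<Sum>\<nu>\<in>?P. complex_of_real (N_factor ?n \<rho>1 y \<mu> \<nu>) * g (\<mu> 3) (\<nu> 3) * (\<Prod>i=3..?n. a i $ \<mu> i $ \<nu> i)) =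
      chain a j $ \<rho>1 $ y * a (Suc ?n) $ y $ x * complex_of_real (eta x l) * ?G"
      using Suc.IH[of y] Suc.prems by simp
  qed
  also have "\<dots> = chain a (Suc j) $ \<rho>1 $ l * ?G"
    by (simp add: matrix_matrix_mult_def sum_distrib_right[symmetric] eval_nat_numeral)
  finally show ?case .
qed

lemma sum_reorder:
  fixes f :: "'a::finite \<Rightarrow> 'a \<Rightarrow> 'a \<Rightarrow> 'a \<Rightarrow> 'a \<Rightarrow> 'a \<Rightarrow> 'b::comm_monoid_add"
  shows "(\<Sum>a\<in>UNIV. \<Sum>b\<in>UNIV. \<Sum>l\<in>UNIV. \<Sum>k\<in>UNIV. \<Sum>r\<in>UNIV. \<Sum>s\<in>UNIV. f a b l k r s) =
    (\<Sum>r\<in>UNIV. \<Sum>s\<in>UNIV. \<Sum>k\<in>UNIV. \<Sum>b\<in>UNIV. \<Sum>a\<in>UNIV. \<Sum>l\<in>UNIV. f a b l k r s)"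
  unfolding sum.cartesian_product
  by (rule sum.reindex_bij_witness[where i = "\<lambda>(r, s, k, b, a, l). (a, b, l, k, r, s)"
        and j = "\<lambda>(a, b, l, k, r, s). (r, s, k, b, a, l)"]) auto

lemma sum_delta_delta:
  fixes A :: "complex ^ 4 ^ 4"
  shows "(\<Sum>\<alpha>\<in>UNIV. \<Sum>\<beta>\<in>UNIV. complex_of_real (delta \<alpha> u * delta \<beta> v) * A $ \<alpha> $ \<beta>) = A $ u $ v"
proof -
  have "(\<Sum>\<alpha>\<in>UNIV. \<Sum>\<beta>\<in>UNIV. complex_of_real (delta \<alpha> u * delta \<beta> v) * A $ \<alpha> $ \<beta>) =
    (\<Sum>\<alpha>\<in>UNIV. \<Sum>\<beta>\<in>UNIV. if \<beta> = v then if \<alpha> = u then A $ \<alpha> $ \<beta> else 0 else 0)"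
    by (intro sum.cong refl) (simp add: delta_def)
  then show ?thesis by simp
qed

text \<open>Isolates the only part of the explicit vertex that contains the indices of particle 3;
  it plays the role of \<open>g\<close> in \<open>N_factor_contract\<close>.\<close>

definition vertex_bracket :: "real ^ 4 \<Rightarrow> real ^ 4 \<Rightarrow> 4 \<Rightarrow> 4 \<Rightarrow> 4 \<Rightarrow> 4 \<Rightarrow> 4 \<Rightarrow> 4 \<Rightarrow> real" where
  "vertex_bracket q q' l k r s \<alpha> \<beta> =
    lower q k * (lower q' r * delta \<alpha> l * delta \<beta> s + lower q' s * delta \<alpha> r * delta \<beta> l
      - lower q' l * delta \<alpha> r * delta \<beta> s)
    - 2 * lower q r * (lower q' s * delta \<alpha> k * delta \<beta> l + lower q' k * delta \<alpha> l * delta \<beta> s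
      - lower q' l * delta \<alpha> s * delta \<beta> k)"

text \<open>The deltas reproduce the three terms of two Christoffel symbols, up to transpositions
  absorbed by the symmetry of \<open>A\<close>. The factor \<open>- 2 * \<i>\<close> undoes the
  \<open>\<i> / 2\<close> in \<open>wave_Gamma\<close>.\<close>

lemma vertex_bracket_contract:
  assumes "transpose A = A"
  shows "(\<Sum>\<alpha>\<in>UNIV. \<Sum>\<beta>\<in>UNIV. complex_of_real (vertex_bracket q q' l k r s \<alpha> \<beta>) * A $ \<alpha> $ \<beta>) =
    - 2 * \<i> * (complex_of_real (lower q k) * wave_Gamma A q' r s l
      - 2 * complex_of_real (lower q r) * wave_Gamma A q' k s l)"
proof -
  have A: "A $ u $ v = A $ v $ u" for u v
    using arg_cong[OF assms, of "\<lambda>M. M $ u $ v"] by (simp add: transpose_def)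
  let ?x = "\<lambda>u v. complex_of_real (lower q u * lower q' v)"
  define D where "D = (\<lambda>u v \<alpha> \<beta>. complex_of_real (delta \<alpha> u * delta \<beta> v) * A $ \<alpha> $ \<beta>)"
  have D: "(\<Sum>\<alpha>\<in>UNIV. \<Sum>\<beta>\<in>UNIV. x * D u v \<alpha> \<beta>) = x * A $ u $ v" for x u v
    unfolding D_def sum_distrib_left[symmetric] sum_delta_delta ..
  have "complex_of_real (vertex_bracket q q' l k r s \<alpha> \<beta>) * A $ \<alpha> $ \<beta> =
    ?x k r * D l s \<alpha> \<beta> + ?x k s * D r l \<alpha> \<beta> - ?x k l * D r s \<alpha> \<beta>
    - (2 * ?x r s) * D k l \<alpha> \<beta> - (2 * ?x r k) * D l s \<alpha> \<beta> + (2 * ?x r l) * D s k \<alpha> \<beta>" for \<alpha> \<beta>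
    by (simp add: vertex_bracket_def D_def algebra_simps)
  then have "(\<Sum>\<alpha>\<in>UNIV. \<Sum>\<beta>\<in>UNIV. complex_of_real (vertex_bracket q q' l k r s \<alpha> \<beta>) * A $ \<alpha> $ \<beta>) =
    (\<Sum>\<alpha>\<in>UNIV. \<Sum>\<beta>\<in>UNIV. ?x k r * D l s \<alpha> \<beta> + ?x k s * D r l \<alpha> \<beta> - ?x k l * D r s \<alpha> \<beta>
    - (2 * ?x r s) * D k l \<alpha> \<beta> - (2 * ?x r k) * D l s \<alpha> \<beta> + (2 * ?x r l) * D s k \<alpha> \<beta>)"
    by (intro sum.cong refl)
  also have "\<dots> = ?x k r * A $ l $ s + ?x k s * A $ r $ l - ?x k l * A $ r $ s
    - (2 * ?x r s) * A $ k $ l - (2 * ?x r k) * A $ l $ s + (2 * ?x r l) * A $ s $ k"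
    unfolding sum.distrib sum_subtractf D ..
  also have "\<dots> = - 2 * \<i> * (complex_of_real (lower q k) * wave_Gamma A q' r s l
      - 2 * complex_of_real (lower q r) * wave_Gamma A q' k s l)"
    by (simp add: wave_Gamma_def A[of s l] A[of l r] A[of l k] A[of k s] algebra_simps)
  finally show ?thesis .
qed

text \<open>The prefactors match: the 4 is made of the 1/2 in the density and the 1/2 in the
  Christoffel symbol. The sign \<open>(- 1) ^ Suc j\<close> is the Neumann sign
  \<open>(- 1) ^ j\<close> times the minus sign of the density; the two factors \<open>\<i>\<close>
  from the derivatives and the sign of \<open>- p 2\<close> cancel each other.\<close>

lemma c_vertex_contract:
  assumes a: "\<And>i. i \<in> {3..j + 3} \<Longrightarrow> transpose (a i) = a i"
  shows "contract (j + 3) (\<lambda>\<rho>1 \<rho>2 \<mu> \<nu>. complex_of_real (c_vertex \<kappa> (j + 3) \<rho>1 \<rho>2 \<mu> \<nu> p)) c b a =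
    complex_of_real \<kappa> ^ Suc j * wave_amplitude j c b a p (- p 2)"
proof -
  let ?n = "j + 3"
  let ?P = "{3..?n} \<rightarrow>\<^sub>E (UNIV :: 4 set)"
  let ?C = "(- complex_of_real \<kappa>) ^ Suc j / 4"
  let ?B = "vertex_bracket (p 2) (p 3)"
  let ?w = "\<lambda>\<rho>1 \<rho>2 k r s. ?C * complex_of_real (eta \<rho>2 k) * complex_of_real (eta r s) * c $ \<rho>1 * b $ \<rho>2"
  let ?g = "\<lambda>k r s l. complex_of_real (lower (p 2) k) * wave_Gamma (a 3) (p 3) r s l
      - 2 * complex_of_real (lower (p 2) r) * wave_Gamma (a 3) (p 3) k s l"
  have cv: "complex_of_real (c_vertex \<kappa> ?n \<rho>1 \<rho>2 \<mu> \<nu> p) = (\<Sum>l\<in>UNIV. \<Sum>k\<in>UNIV. \<Sum>r\<in>UNIV. \<Sum>s\<in>UNIV.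
      ?C * complex_of_real (N_factor ?n \<rho>1 l \<mu> \<nu>) * complex_of_real (eta \<rho>2 k) * complex_of_real (eta r s) *
      complex_of_real (?B l k r s (\<mu> 3) (\<nu> 3)))" for \<rho>1 \<rho>2 \<mu> \<nu>
    unfolding c_vertex_def vertex_bracket_def[symmetric]
    by (simp add: sum_distrib_left mult_ac)
  have N: "(\<Sum>\<mu>\<in>?P. \<Sum>\<nu>\<in>?P. complex_of_real (N_factor ?n \<rho>1 l \<mu> \<nu>) * complex_of_real (?B l k r s (\<mu> 3) (\<nu> 3)) *
       (\<Prod>i=3..?n. a i $ \<mu> i $ \<nu> i)) =
      chain a j $ \<rho>1 $ l * (\<Sum>\<alpha>\<in>UNIV. \<Sum>\<beta>\<in>UNIV. complex_of_real (?B l k r s \<alpha> \<beta>) * a 3 $ \<alpha> $ \<beta>)" for \<rho>1 l k r s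
    by (rule N_factor_contract[OF a])
  have a3: "transpose (a 3) = a 3"
    by (rule a) simp
  have "contract ?n (\<lambda>\<rho>1 \<rho>2 \<mu> \<nu>. complex_of_real (c_vertex \<kappa> ?n \<rho>1 \<rho>2 \<mu> \<nu> p)) c b a =
    (\<Sum>\<rho>1\<in>UNIV. \<Sum>\<rho>2\<in>UNIV. \<Sum>\<mu>\<in>?P. \<Sum>\<nu>\<in>?P. \<Sum>l\<in>UNIV. \<Sum>k\<in>UNIV. \<Sum>r\<in>UNIV. \<Sum>s\<in>UNIV. ?w \<rho>1 \<rho>2 k r s *
      (complex_of_real (N_factor ?n \<rho>1 l \<mu> \<nu>) * complex_of_real (?B l k r s (\<mu> 3) (\<nu> 3)) *
       (\<Prod>i=3..?n. a i $ \<mu> i $ \<nu> i)))"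
    unfolding contract_def cv sum_distrib_right
    by (intro sum.cong refl) (simp only: mult_ac)
  also have "\<dots> = (\<Sum>\<rho>1\<in>UNIV. \<Sum>\<rho>2\<in>UNIV. \<Sum>l\<in>UNIV. \<Sum>k\<in>UNIV. \<Sum>r\<in>UNIV. \<Sum>s\<in>UNIV. ?w \<rho>1 \<rho>2 k r s *
      (\<Sum>\<mu>\<in>?P. \<Sum>\<nu>\<in>?P. complex_of_real (N_factor ?n \<rho>1 l \<mu> \<nu>) * complex_of_real (?B l k r s (\<mu> 3) (\<nu> 3)) *
       (\<Prod>i=3..?n. a i $ \<mu> i $ \<nu> i)))"
    unfolding sum_distrib_left sum.swap[of _ UNIV ?P] ..
  also have "\<dots> = (\<Sum>\<rho>1\<in>UNIV. \<Sum>\<rho>2\<in>UNIV. \<Sum>l\<in>UNIV. \<Sum>k\<in>UNIV. \<Sum>r\<in>UNIV. \<Sum>s\<in>UNIV. ?w \<rho>1 \<rho>2 k r s *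
      (chain a j $ \<rho>1 $ l * (- 2 * \<i> * ?g k r s l)))"
    by (simp only: N vertex_bracket_contract[OF a3])
  also have "\<dots> = (\<Sum>r\<in>UNIV. \<Sum>s\<in>UNIV. \<Sum>k\<in>UNIV. \<Sum>\<rho>2\<in>UNIV. \<Sum>\<rho>1\<in>UNIV. \<Sum>l\<in>UNIV. ?w \<rho>1 \<rho>2 k r s *
      (chain a j $ \<rho>1 $ l * (- 2 * \<i> * ?g k r s l)))"
    by (rule sum_reorder)
  also have "\<dots> = (\<Sum>r\<in>UNIV. \<Sum>s\<in>UNIV. \<Sum>k\<in>UNIV. \<Sum>\<rho>2\<in>UNIV.
      (?C * complex_of_real (eta r s) * - 2 * \<i>) * (complex_of_real (eta k \<rho>2) * b $ \<rho>2) *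
      (complex_of_real (lower (p 2) k) * chain_Gamma j c a p r s
       - 2 * complex_of_real (lower (p 2) r) * chain_Gamma j c a p k s))"
    unfolding chain_Gamma_def sum_distrib_left sum_subtractf[symmetric]
    by (intro sum.cong refl) (simp add: eta_commute algebra_simps)
  also have "\<dots> = (\<Sum>r\<in>UNIV. \<Sum>s\<in>UNIV. \<Sum>k\<in>UNIV.
      (?C * complex_of_real (eta r s) * - 2 * \<i>) * raise b k *
      (complex_of_real (lower (p 2) k) * chain_Gamma j c a p r s
       - 2 * complex_of_real (lower (p 2) r) * chain_Gamma j c a p k s))"
    by (simp only: raise_def sum_distrib_left sum_distrib_right)
  also have "\<dots> = complex_of_real \<kappa> ^ Suc j * wave_amplitude j c b a p (- p 2)"
    unfolding wave_amplitude_def sum_distrib_left lower_minus power_minus[of "complex_of_real \<kappa>"]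
    by (intro sum.cong refl) (simp add: algebra_simps)
  finally show ?thesis .
qed

lemma c_vertex_cong:
  assumes "\<And>i. i \<in> {3..n} \<Longrightarrow> \<mu> i = \<mu>' i" "\<And>i. i \<in> {3..n} \<Longrightarrow> \<nu> i = \<nu>' i" "n \<ge> 3"
  shows "c_vertex \<kappa> n \<rho>1 \<rho>2 \<mu> \<nu> p = c_vertex \<kappa> n \<rho>1 \<rho>2 \<mu>' \<nu>' p"
proof -
  have "N_factor n \<rho>1 l \<mu> \<nu> = N_factor n \<rho>1 l \<mu>' \<nu>'" for l
    by (rule N_factor_cong[OF assms])
  moreover have "\<mu> 3 = \<mu>' 3" "\<nu> 3 = \<nu>' 3"
    using assms by auto
  ultimately show ?thesis
    by (simp add: c_vertex_def)
qed

section \<open>Assembly of the vertex rule with gravitons\<close>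

definition ordered_vertex :: "real \<Rightarrow> nat \<Rightarrow> (nat \<Rightarrow> real ^ 4) \<Rightarrow> vertex_tensor" where
  "ordered_vertex \<kappa> n p \<rho>1 \<rho>2 \<mu> \<nu> = \<i> * (\<Sum>s | s permutes {3..n}.
     complex_of_real (c_vertex \<kappa> n \<rho>1 \<rho>2 (\<mu> \<circ> s) (\<nu> \<circ> s) (p \<circ> s)))"

text \<open>Symmetric amplitudes do not notice the averaging, and each permutation can be moved onto
  amplitudes and momenta. This leaves the same sum over permutations as in the multilinear
  coefficient of the density.\<close>

lemma is_ghost_vertex_ordered:
  assumes n: "n > 2" and mom: "(\<Sum>i=1..n. p i) = 0"
  shows "is_ghost_vertex \<kappa> \<zeta> n p (symmetrise n (ordered_vertex \<kappa> n p))"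
  unfolding is_ghost_vertex_def
proof (intro conjI allI impI)
  obtain j where j: "n = j + 3"
    using n that[of "n - 3"] by simp
  have "is_vertex_tensor n (ordered_vertex \<kappa> n p)"
    unfolding is_vertex_tensor_def ordered_vertex_def
  proof (intro allI impI arg_cong2[where f = "(*)"] sum.cong refl arg_cong[where f = complex_of_real])
    fix \<rho>1 \<rho>2 s and \<mu> \<nu> \<mu>' \<nu>' :: "nat \<Rightarrow> 4"
    assume eq: "\<forall>i\<in>{3..n}. \<mu> i = \<mu>' i \<and> \<nu> i = \<nu>' i" and "s \<in> {s. s permutes {3..n}}"
    then have "s i \<in> {3..n}" if "i \<in> {3..n}" for i
      using that permutes_in_image[of s "{3..n}" i] by simp
    then show "c_vertex \<kappa> n \<rho>1 \<rho>2 (\<mu> \<circ> s) (\<nu> \<circ> s) (p \<circ> s) = c_vertex \<kappa> n \<rho>1 \<rho>2 (\<mu>' \<circ> s) (\<nu>' \<circ> s) (p \<circ> s)"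
      using eq n by (intro c_vertex_cong) simp_all
  qed
  then show "is_vertex_tensor n (symmetrise n (ordered_vertex \<kappa> n p))"
    by (rule symmetrise_vertex_tensor)
  show "pair_symmetric n (symmetrise n (ordered_vertex \<kappa> n p))"
    by (rule symmetrise_pair_symmetric)
  fix c b :: "complex ^ 4" and a :: "nat \<Rightarrow> complex ^ 4 ^ 4"
  assume a: "\<forall>i\<in>{3..n}. transpose (a i) = a i"
  let ?Q = "\<Sum>s | s permutes {3..n}. complex_of_real \<kappa> ^ Suc j * wave_amplitude j c b (a \<circ> s) (p \<circ> s) (- p 2)"
  have "contract n (symmetrise n (ordered_vertex \<kappa> n p)) c b a = contract n (ordered_vertex \<kappa> n p) c b a"
    using a by (intro contract_symmetrise) simp
  also have "\<dots> = \<i> * (\<Sum>s | s permutes {3..n}. contract n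
      (\<lambda>\<rho>1 \<rho>2 \<mu> \<nu>. complex_of_real (c_vertex \<kappa> n \<rho>1 \<rho>2 (\<mu> \<circ> s) (\<nu> \<circ> s) (p \<circ> s))) c b a)"
    unfolding ordered_vertex_def[abs_def] contract_cmult contract_sum ..
  also have "(\<Sum>s | s permutes {3..n}. contract n
      (\<lambda>\<rho>1 \<rho>2 \<mu> \<nu>. complex_of_real (c_vertex \<kappa> n \<rho>1 \<rho>2 (\<mu> \<circ> s) (\<nu> \<circ> s) (p \<circ> s))) c b a) = ?Q"
  proof (intro sum.cong refl)
    fix s assume "s \<in> {s. s permutes {3..n}}"
    then have s: "s permutes {3..n}" by simp
    have "contract n (\<lambda>\<rho>1 \<rho>2 \<mu> \<nu>. complex_of_real (c_vertex \<kappa> n \<rho>1 \<rho>2 (\<mu> \<circ> s) (\<nu> \<circ> s) (p \<circ> s))) c b a =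
      contract n (\<lambda>\<rho>1 \<rho>2 \<mu> \<nu>. complex_of_real (c_vertex \<kappa> n \<rho>1 \<rho>2 \<mu> \<nu> (p \<circ> s))) c b (a \<circ> s)"
      by (rule contract_permute[OF s, of "\<lambda>\<rho>1 \<rho>2 \<mu> \<nu>. complex_of_real (c_vertex \<kappa> n \<rho>1 \<rho>2 \<mu> \<nu> (p \<circ> s))"])
    also have "\<dots> = complex_of_real \<kappa> ^ Suc j * wave_amplitude j c b (a \<circ> s) (p \<circ> s) (- (p \<circ> s) 2)"
      unfolding j
    proof (rule c_vertex_contract)
      fix i assume "i \<in> {3..j + 3}"
      then have "s i \<in> {3..n}"
        using permutes_in_image[OF s] j by simp
      then show "transpose ((a \<circ> s) i) = (a \<circ> s) i"
        using a by simp
    qed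
    also have "(p \<circ> s) 2 = p 2"
      using permutes_not_in[OF s, of 2] by simp
    finally show "contract n (\<lambda>\<rho>1 \<rho>2 \<mu> \<nu>. complex_of_real (c_vertex \<kappa> n \<rho>1 \<rho>2 (\<mu> \<circ> s) (\<nu> \<circ> s) (p \<circ> s))) c b a =
      complex_of_real \<kappa> ^ Suc j * wave_amplitude j c b (a \<circ> s) (p \<circ> s) (- p 2)" .
  qed
  finally have "contract n (symmetrise n (ordered_vertex \<kappa> n p)) c b a = \<i> * ?Q" .
  moreover have "n - 2 = Suc j"
    using j by simp
  ultimately show "\<exists>Q. (\<forall>x. has_multilinear_coeff
      (\<lambda>\<epsilon>. ghost_order (n - 2) \<kappa> \<zeta> (wave_tensor n \<epsilon> a p) (wave_covector c (p 1)) (wave_covector b (p 2)) x) {3..n} Q) \<and>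
      contract n (symmetrise n (ordered_vertex \<kappa> n p)) c b a = \<i> * Q"
    using has_multilinear_coeff_wave[OF j mom] by (intro exI[of _ ?Q]) (simp only: simp_thms)
qed

section \<open>The two-point rule\<close>

lemma mdot_self: "(\<Sum>\<rho>\<in>UNIV. \<Sum>\<sigma>\<in>UNIV. eta \<rho> \<sigma> * (lower q \<rho> * lower q \<sigma>)) = mdot q q"
proof -
  have eta_sum: "(\<Sum>\<nu>\<in>UNIV. eta \<mu> \<nu> * f \<nu>) = (if \<mu> = 0 then 1 else - 1) * f \<mu>" for \<mu> and f :: "4 \<Rightarrow> real"
    by (simp add: eta_def if_distrib[of "\<lambda>x. x * _"] cong: if_cong)
  show ?thesis
    by (simp add: mdot_def lower_def eta_sum mult.assoc) (auto intro!: sum.cong)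
qed

text \<open>Two derivatives of the ghost wave contribute \<open>\<i> * \<i>\<close>, which cancels
  the minus sign of the kinetic term; the opposite momentum of the antighost removes the
  exponential.\<close>

lemma ghost_kinetic_wave:
  "ghost_kinetic \<zeta> (wave_covector c q) (wave_covector b (- q)) x =
    1 / (2 * complex_of_real \<zeta>) * complex_of_real (mdot q q) *
      (\<Sum>\<mu>\<in>UNIV. \<Sum>\<nu>\<in>UNIV. complex_of_real (eta \<mu> \<nu>) * c $ \<mu> * b $ \<nu>)"
proof -
  have "partial \<rho> (partial \<sigma> (\<lambda>y. wave_covector c q y $ \<mu>)) x =
    - (complex_of_real (lower q \<rho> * lower q \<sigma>) * c $ \<mu> * wave q x)" for \<rho> \<sigma> \<mu>
  proof -
    have "partial \<sigma> (\<lambda>y. wave_covector c q y $ \<mu>) = (\<lambda>y. c $ \<mu> * (\<i> * complex_of_real (lower q \<sigma>)) * wave q y)"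
      by (simp add: wave_covector_def fun_eq_iff partial_cmult partial_wave)
    then show ?thesis
      by (simp add: partial_cmult partial_wave) (simp add: algebra_simps)
  qed
  moreover have "e * (r * wave (- q) x) * - (t * z * wave q x) = e * t * - (r * z)" for e r t z :: complex
  proof -
    have "e * (r * wave (- q) x) * - (t * z * wave q x) = e * t * - (r * z) * (wave (- q) x * wave q x)"
      by (simp add: mult_ac)
    then show ?thesis
      by (simp flip: wave_add)
  qed
  ultimately have "(\<Sum>\<rho>\<in>UNIV. \<Sum>\<sigma>\<in>UNIV. \<Sum>\<mu>\<in>UNIV. complex_of_real (eta \<rho> \<sigma>) * raise (wave_covector b (- q) x) \<mu> *
      partial \<rho> (partial \<sigma> (\<lambda>y. wave_covector c q y $ \<mu>)) x) =
    (\<Sum>\<rho>\<in>UNIV. \<Sum>\<sigma>\<in>UNIV. complex_of_real (eta \<rho> \<sigma> * (lower q \<rho> * lower q \<sigma>)) * - (\<Sum>\<mu>\<in>UNIV. raise b \<mu> * c $ \<mu>))"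
    by (simp only: raise_wave_covector sum_distrib_left sum_negf[symmetric] of_real_mult[of "eta _ _"])
  also have "\<dots> = - (complex_of_real (mdot q q) * (\<Sum>\<mu>\<in>UNIV. raise b \<mu> * c $ \<mu>))"
    unfolding mdot_self[symmetric] by (simp add: sum_distrib_right sum_negf)
  also have "(\<Sum>\<mu>\<in>UNIV. raise b \<mu> * c $ \<mu>) = (\<Sum>\<mu>\<in>UNIV. \<Sum>\<nu>\<in>UNIV. complex_of_real (eta \<mu> \<nu>) * c $ \<mu> * b $ \<nu>)"
    by (simp add: raise_def sum_distrib_left mult_ac)
  finally show ?thesis
    by simp
qed

text \<open>Covers the case without gravitons: \<open>{3..2}\<close> is empty and the multilinear
  monomial is the constant 1.\<close>

lemma has_multilinear_coeff_const: "has_multilinear_coeff (\<lambda>_. Q) {} Q"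
  unfolding has_multilinear_coeff_alt
  by (rule exI[of _ "Poly_Mapping.single 0 Q"]) (simp add: poly_eval_single monom_eval_def)

lemma is_ghost_vertex_2:
  assumes "p 1 = q" "p 2 = - q"
  shows "is_ghost_vertex \<kappa> \<zeta> 2 p
    (\<lambda>\<rho>1 \<rho>2 \<mu> \<nu>. \<i> / (2 * complex_of_real \<zeta>) * complex_of_real (mdot q q * eta \<rho>1 \<rho>2))" (is "is_ghost_vertex _ _ _ _ ?T")
  unfolding is_ghost_vertex_def
proof (intro conjI allI impI)
  show "is_vertex_tensor 2 ?T" "pair_symmetric 2 ?T"
    by (simp_all add: is_vertex_tensor_def pair_symmetric_def)
  fix c b :: "complex ^ 4" and a :: "nat \<Rightarrow> complex ^ 4 ^ 4"
  let ?Q = "1 / (2 * complex_of_real \<zeta>) * complex_of_real (mdot q q) *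
      (\<Sum>\<mu>\<in>UNIV. \<Sum>\<nu>\<in>UNIV. complex_of_real (eta \<mu> \<nu>) * c $ \<mu> * b $ \<nu>)"
  have "has_multilinear_coeff
      (\<lambda>\<epsilon>. ghost_order (2 - 2) \<kappa> \<zeta> (wave_tensor 2 \<epsilon> a p) (wave_covector c (p 1)) (wave_covector b (p 2)) x) {3..2} ?Q" for x
    using has_multilinear_coeff_const[of ?Q]
    by (simp only: diff_self_eq_0 ghost_order_0 assms ghost_kinetic_wave) simp
  moreover have "contract 2 ?T c b a = \<i> * ?Q"
    by (simp add: contract_def sum_distrib_left sum_divide_distrib mult_ac)
  ultimately show "\<exists>Q. (\<forall>x. has_multilinear_coeff
      (\<lambda>\<epsilon>. ghost_order (2 - 2) \<kappa> \<zeta> (wave_tensor 2 \<epsilon> a p) (wave_covector c (p 1)) (wave_covector b (p 2)) x) {3..2} Q) \<and>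
      contract 2 ?T c b a = \<i> * Q"
    by blast
qed

theorem theorem4p13:
  fixes \<kappa> \<zeta> :: real and h :: "real ^ 4 \<Rightarrow> real ^ 4 ^ 4"
  assumes "\<zeta> \<noteq> 0"
    and "smooth_field h"
    and "\<And>x. transpose (h x) = h x"
    and "\<And>x l. l \<in> EW (h x) \<Longrightarrow> \<bar>\<kappa>\<bar> * \<bar>l\<bar> < 1"
  shows "(\<forall>C Cb x. smooth_field C \<longrightarrow> smooth_field Cb \<longrightarrow>
            (\<lambda>m. ghost_order m \<kappa> \<zeta> (complexify h) C Cb x) sums
              ghost_lagrangian (complex_of_real \<kappa>) \<zeta> (complexify h) C Cb x)
       \<and> (\<forall>p q \<rho>1 \<rho>2 \<mu> \<nu>. p 1 = q \<and> p 2 = - q \<longrightarrow>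
            ghost_vertex \<kappa> \<zeta> 2 p \<rho>1 \<rho>2 \<mu> \<nu> =
              \<i> / (2 * complex_of_real \<zeta>) * complex_of_real (mdot q q * eta \<rho>1 \<rho>2))
       \<and> (\<forall>n p \<rho>1 \<rho>2 \<mu> \<nu>. n > 2 \<and> (\<Sum>i=1..n. p i) = 0 \<longrightarrow>
            ghost_vertex \<kappa> \<zeta> n p \<rho>1 \<rho>2 \<mu> \<nu> =
              \<i> / 2 ^ (n - 2) *
              (\<Sum>S\<in>Pow {3..n}. \<Sum>s | s permutes {3..n}.
                 complex_of_real (c_vertex \<kappa> n \<rho>1 \<rho>2
                   (swap_at S \<mu> \<nu> \<circ> s) (swap_at S \<nu> \<mu> \<circ> s) (p \<circ> s))))"
proof (intro conjI allI impI)
  fix C Cb :: covector_field and x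
  assume "smooth_field C"
  then show "(\<lambda>m. ghost_order m \<kappa> \<zeta> (complexify h) C Cb x) sums
      ghost_lagrangian (complex_of_real \<kappa>) \<zeta> (complexify h) C Cb x"
    using assms by (intro ghost_order_sums)
next
  fix p :: "nat \<Rightarrow> real ^ 4" and q \<rho>1 \<rho>2 \<mu> \<nu>
  assume "p 1 = q \<and> p 2 = - q"
  then show "ghost_vertex \<kappa> \<zeta> 2 p \<rho>1 \<rho>2 \<mu> \<nu> =
      \<i> / (2 * complex_of_real \<zeta>) * complex_of_real (mdot q q * eta \<rho>1 \<rho>2)"
    using ghost_vertex_eq[OF is_ghost_vertex_2] by simp
next
  fix n and p :: "nat \<Rightarrow> real ^ 4" and \<rho>1 \<rho>2 \<mu> \<nu>
  assume n: "n > 2 \<and> (\<Sum>i=1..n. p i) = 0"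
  then have "ghost_vertex \<kappa> \<zeta> n p = symmetrise n (ordered_vertex \<kappa> n p)"
    by (intro ghost_vertex_eq is_ghost_vertex_ordered) simp_all
  moreover have "card {3..n} = n - 2"
    by simp
  ultimately show "ghost_vertex \<kappa> \<zeta> n p \<rho>1 \<rho>2 \<mu> \<nu> =
      \<i> / 2 ^ (n - 2) *
      (\<Sum>S\<in>Pow {3..n}. \<Sum>s | s permutes {3..n}.
         complex_of_real (c_vertex \<kappa> n \<rho>1 \<rho>2
           (swap_at S \<mu> \<nu> \<circ> s) (swap_at S \<nu> \<mu> \<circ> s) (p \<circ> s)))"
    by (simp add: symmetrise_def ordered_vertex_def sum_distrib_left sum_divide_distrib)
qed

end
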